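(* Let $u_h^{-1}=u_h^0=\Pi u_0\in V_h$ and $U^{-1}=U^0=\sqrt{F(u_0)+B}$. For time step $\Delta t>0$ and $n\ge 0$ put $u_h^{n,*}=2u_h^n-u_h^{n-1}$, and consider the second order fully discrete BDF2-IEQ-FEM2 scheme for the Allen-Cahn equation: find $u_h^{n+1}\in V_h$ and $U^{n+1}\in C^0(\Omega)$ such that for all $\phi\in V_h$ $$\left(\frac{3u_h^{n+1}-4u_h^n+u_h^{n-1}}{2\Delta t},\phi\right)=-A(\epsilon^2;u_h^{n+1},\phi)-\left(H(u_h^{n,*})U^{n+1},\phi\right),$$ $$\frac{3U^{n+1}-4U^n+U^{n-1}}{2\Delta t}=\frac12H(u_h^{n,*})\frac{3u_h^{n+1}-4u_h^n+u_h^{n-1}}{2\Delta t}.$$ This scheme admits a unique solution $u_h^{n+1}\in V_h$ and $U^{n+1}\in C^0(\Omega)$ satisfying the energy dissipation law $$\bar E^{n+1}=\bar E^n-\frac1{2\Delta t}\|3u_h^{n+1}-4u_h^n+u_h^{n-1}\|^2-\frac14A(\epsilon^2;u_h^{n+1}-u_h^{n,*},u_h^{n+1}-u_h^{n,*})-\frac12\|U^{n+1}-U^{n,*}\|^2,$$ for any $\Delta t>0$, where $\bar E^n=\frac12\left(E(u_h^n,U^n)+E(u_h^{n,*},U^{n,*})\right)$ with $U^{n,*}=2U^n-U^{n-1}$.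
   Context: The Allen-Cahn equation is $u_t=\epsilon^2\Delta u-F'(u)$ in $\Omega\times(0,T]$, with $\nabla u\cdot n=0$ on $\partial\Omega$ ($n$ the unit outward normal) and initial data $u_0$. Here $\Omega\subseteq\mathbb{R}^d$ ($d=2,3$) is a bounded domain, $\epsilon>0$ is a parameter, and $F$ is the nonlinear bulk potential (well-known examples: the double well potential $F(u)=\frac14(u^2-1)^2$ and the logarithmic Flory–Huggins potential $F(u)=\frac{\theta}{2}(u\ln u+(1-u)\ln(1-u))+\frac{\theta_c}{2}u(1-u)$ with $\theta,\theta_c>0$). $B\ge0$ is a constant such that $F+B>0$ at the functions where it is evaluated, and $H(w)=F'(w)/\sqrt{F(w)+B}$. $\mathcal T$ is a quasi-uniform triangulation of $\Omega=\cup_{i=1}^N T_i$, and $V_h=\{v\in C^0(\Omega)\cap H^1(\Omega): v|_{T_i}\in P_k\ \forall T_i\in\mathcal T\}$, with $P_k$ the space of polynomials of degree no more than $k$. $(\cdot,\cdot)$ and $\|\cdot\|$ are the $L^2(\Omega)$ inner product and norm, and $\Pi$ is the $L^2$ projection onto $V_h$. For a coefficient $a(x)$, $A(a;q,v)=\int_\Omega a(x)\nabla q\cdot\nabla v\,dx$. The energy is $E(v,V)=\frac12A(\epsilon^2;v,v)+\int_\Omega V^2\,dx-B|\Omega|$.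
   Formalization: The coefficient of ‖3u_h^{n+1}−4u_h^n+u_h^{n−1}‖² in the energy law is 1/(4Δt), not the printed 1/(2Δt); the printed law fails whenever this norm is nonzero, e.g. n=0 and u_0 a constant c with F'(c)≠0. *)

theory Defs
  imports "HOL-Analysis.Analysis"
begin

section \<open>Lebesgue and Sobolev spaces\<close>

definition L2 :: "(real^'d) set \<Rightarrow> (real^'d \<Rightarrow> 'b::euclidean_space) set" where
  "L2 \<Omega> = {f. f \<in> borel_measurable (lebesgue_on \<Omega>) \<and>
              integrable (lebesgue_on \<Omega>) (\<lambda>x. (norm (f x))\<^sup>2)}"

definition l2_inner :: "(real^'d) set \<Rightarrow> (real^'d \<Rightarrow> real) \<Rightarrow> (real^'d \<Rightarrow> real) \<Rightarrow> real" where
  "l2_inner \<Omega> f g = (LINT x|lebesgue_on \<Omega>. f x * g x)"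

definition l2_norm :: "(real^'d) set \<Rightarrow> (real^'d \<Rightarrow> real) \<Rightarrow> real" where
  "l2_norm \<Omega> f = sqrt (l2_inner \<Omega> f f)"

text \<open>Weak gradients are tested against the continuously differentiable functions with compact
  support in the open set \<open>\<Omega>\<close>.\<close>

definition has_weak_gradient ::
  "(real^'d) set \<Rightarrow> (real^'d \<Rightarrow> real) \<Rightarrow> (real^'d \<Rightarrow> real^'d) \<Rightarrow> bool" where
  "has_weak_gradient \<Omega> v g \<longleftrightarrow>
     (\<forall>\<phi> D\<phi>. (\<forall>x. GDERIV \<phi> x :> D\<phi> x) \<and> continuous_on UNIV D\<phi> \<and>
        (\<exists>K. compact K \<and> K \<subseteq> \<Omega> \<and> (\<forall>x. x \<notin> K \<longrightarrow> \<phi> x = 0)) \<longrightarrow>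
        (LINT x|lebesgue_on \<Omega>. v x *\<^sub>R D\<phi> x) = - (LINT x|lebesgue_on \<Omega>. \<phi> x *\<^sub>R g x))"

definition H1 :: "(real^'d) set \<Rightarrow> (real^'d \<Rightarrow> real) set" where
  "H1 \<Omega> = {v \<in> L2 \<Omega>. \<exists>g \<in> L2 \<Omega>. has_weak_gradient \<Omega> v g}"

text \<open>The weak gradient is unique up to null sets; a representative is chosen.\<close>

definition weak_grad :: "(real^'d) set \<Rightarrow> (real^'d \<Rightarrow> real) \<Rightarrow> real^'d \<Rightarrow> real^'d" where
  "weak_grad \<Omega> v = (SOME g. g \<in> L2 \<Omega> \<and> has_weak_gradient \<Omega> v g)"

definition bilin_A ::
  "(real^'d) set \<Rightarrow> (real^'d \<Rightarrow> real) \<Rightarrow> (real^'d \<Rightarrow> real) \<Rightarrow> (real^'d \<Rightarrow> real) \<Rightarrow> real" where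
  "bilin_A \<Omega> a q v = (LINT x|lebesgue_on \<Omega>. a x * (weak_grad \<Omega> q x \<bullet> weak_grad \<Omega> v x))"

text \<open>Continuity is up to the boundary (the closed elements cover the closure of \<open>\<Omega>\<close>).  A
  function on \<open>closure \<Omega>\<close> is represented by its extension by zero, so that equality of
  elements of \<open>C0 \<Omega>\<close> is equality as functions on \<open>closure \<Omega>\<close>.\<close>

definition C0 :: "(real^'d) set \<Rightarrow> (real^'d \<Rightarrow> real) set" where
  "C0 \<Omega> = {f. continuous_on (closure \<Omega>) f \<and> (\<forall>x. x \<notin> closure \<Omega> \<longrightarrow> f x = 0)}"

section \<open>Finite element spaces\<close>

text \<open>Polynomials of total degree at most \<open>k\<close> in the coordinates; \<open>\<alpha>\<close> ranges over the
  multi-indices of order at most \<open>k\<close>.\<close>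

definition polynomials_le :: "nat \<Rightarrow> (real^'d \<Rightarrow> real) set" where
  "polynomials_le k =
     {p. \<exists>c. \<forall>x. p x = (\<Sum>\<alpha> | (\<Sum>i\<in>UNIV. \<alpha> i) \<le> k. c \<alpha> * (\<Prod>i\<in>UNIV. x $ i ^ \<alpha> i))}"

definition mesh_size :: "(real^'d) set set \<Rightarrow> real" where
  "mesh_size \<T> = Max (diameter ` \<T>)"

text \<open>A conforming mesh of closed nondegenerate simplices such that every element contains a
  ball of radius \<open>\<rho>\<close> times the mesh size.\<close>

definition quasi_uniform_triangulation ::
  "real \<Rightarrow> (real^'d) set \<Rightarrow> (real^'d) set set \<Rightarrow> bool" where
  "quasi_uniform_triangulation \<rho> \<Omega> \<T> \<longleftrightarrow>
     triangulation \<T> \<and> (\<forall>T\<in>\<T>. int CARD('d) simplex T) \<and> \<Union>\<T> = closure \<Omega> \<and>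
     0 < \<rho> \<and> (\<forall>T\<in>\<T>. \<exists>z. cball z (\<rho> * mesh_size \<T>) \<subseteq> T)"

definition fe_space :: "(real^'d) set \<Rightarrow> (real^'d) set set \<Rightarrow> nat \<Rightarrow> (real^'d \<Rightarrow> real) set" where
  "fe_space \<Omega> \<T> k =
     {v \<in> C0 \<Omega> \<inter> H1 \<Omega>. \<forall>T\<in>\<T>. \<exists>p\<in>polynomials_le k. \<forall>x\<in>T. v x = p x}"

definition l2_projection ::
  "(real^'d) set \<Rightarrow> (real^'d \<Rightarrow> real) set \<Rightarrow> (real^'d \<Rightarrow> real) \<Rightarrow> real^'d \<Rightarrow> real" where
  "l2_projection \<Omega> V f = (THE w. w \<in> V \<and> (\<forall>\<phi>\<in>V. l2_inner \<Omega> w \<phi> = l2_inner \<Omega> f \<phi>))"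

section \<open>The IEQ scheme\<close>

definition ieq_H :: "(real \<Rightarrow> real) \<Rightarrow> real \<Rightarrow> real \<Rightarrow> real" where
  "ieq_H F B w = deriv F w / sqrt (F w + B)"

text \<open>The argument order in the following definitions is chronological: \<open>w0, w1, w2\<close> stand for
  the time levels \<open>n - 1, n, n + 1\<close>.\<close>

definition extrap :: "('a \<Rightarrow> real) \<Rightarrow> ('a \<Rightarrow> real) \<Rightarrow> 'a \<Rightarrow> real" where
  "extrap w0 w1 = (\<lambda>x. 2 * w1 x - w0 x)"

definition bdf2 :: "('a \<Rightarrow> real) \<Rightarrow> ('a \<Rightarrow> real) \<Rightarrow> ('a \<Rightarrow> real) \<Rightarrow> 'a \<Rightarrow> real" where
  "bdf2 w0 w1 w2 = (\<lambda>x. 3 * w2 x - 4 * w1 x + w0 x)"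

definition energy ::
  "(real^'d) set \<Rightarrow> real \<Rightarrow> real \<Rightarrow> (real^'d \<Rightarrow> real) \<Rightarrow> (real^'d \<Rightarrow> real) \<Rightarrow> real" where
  "energy \<Omega> \<epsilon> B v V = 1/2 * bilin_A \<Omega> (\<lambda>_. \<epsilon>\<^sup>2) v v
     + (LINT x|lebesgue_on \<Omega>. (V x)\<^sup>2) - B * measure lebesgue \<Omega>"

definition energy_bar ::
  "(real^'d) set \<Rightarrow> real \<Rightarrow> real \<Rightarrow> (real^'d \<Rightarrow> real) \<Rightarrow> (real^'d \<Rightarrow> real) \<Rightarrow>
     (real^'d \<Rightarrow> real) \<Rightarrow> (real^'d \<Rightarrow> real) \<Rightarrow> real" where
  "energy_bar \<Omega> \<epsilon> B u0 u1 U0 U1 =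
     1/2 * (energy \<Omega> \<epsilon> B u1 U1 + energy \<Omega> \<epsilon> B (extrap u0 u1) (extrap U0 U1))"

definition bdf2_ieq_step ::
  "(real^'d) set \<Rightarrow> (real^'d \<Rightarrow> real) set \<Rightarrow> (real \<Rightarrow> real) \<Rightarrow> real \<Rightarrow> real \<Rightarrow> real \<Rightarrow>
     (real^'d \<Rightarrow> real) \<Rightarrow> (real^'d \<Rightarrow> real) \<Rightarrow> (real^'d \<Rightarrow> real) \<Rightarrow>
     (real^'d \<Rightarrow> real) \<Rightarrow> (real^'d \<Rightarrow> real) \<Rightarrow> (real^'d \<Rightarrow> real) \<Rightarrow> bool" where
  "bdf2_ieq_step \<Omega> V F B \<epsilon> \<Delta>t u0 u1 u2 U0 U1 U2 \<longleftrightarrow>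
     u2 \<in> V \<and> U2 \<in> C0 \<Omega> \<and>
     (\<forall>\<phi>\<in>V. l2_inner \<Omega> (\<lambda>x. bdf2 u0 u1 u2 x / (2 * \<Delta>t)) \<phi> =
        - bilin_A \<Omega> (\<lambda>_. \<epsilon>\<^sup>2) u2 \<phi>
        - l2_inner \<Omega> (\<lambda>x. ieq_H F B (extrap u0 u1 x) * U2 x) \<phi>) \<and>
     (\<forall>x\<in>closure \<Omega>. bdf2 U0 U1 U2 x / (2 * \<Delta>t) =
        1/2 * ieq_H F B (extrap u0 u1 x) * (bdf2 u0 u1 u2 x / (2 * \<Delta>t)))"

end

theory Submission
  imports Defs
begin

text \<open>The auxiliary equation is pointwise and linear in the new auxiliary variable, with a continuous
  coefficient \<open>H\<close>.  Solving it and substituting reduces a time step to a linear problem on the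
  finite element space alone, whose form
  \<open>((3 / (2 \<Delta>t) + H\<^sup>2 / 2) v, \<phi>) + A(\<epsilon>\<^sup>2; v, \<phi>)\<close> is symmetric and positive definite for
  every time step (\<open>step_iff\<close>, \<open>condensed_form_pos\<close>).  Since the finite element space is contained
  in the span of finitely many functions (\<open>fe_space_spanned\<close>), a finite-dimensional Riesz theorem
  (\<open>riesz_finite_dimensional\<close>) gives exactly one solution.  The same theorem shows that the \<open>L\<^sup>2\<close>
  projection of the initial data is well defined.

  For the energy law, test with \<open>3 u\<^sup>n\<^sup>+\<^sup>1 - 4 u\<^sup>n + u\<^sup>n\<^sup>-\<^sup>1\<close>.  The auxiliary equation converts the
  nonlinear term into an inner product of the new auxiliary variable with its own BDF2 difference,
  and the algebraic identity \<open>bdf2_identity\<close> turns both that product and the gradient term into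
  differences of squares (\<open>energy_law\<close>).

  Both halves need \<open>A\<close> to be bilinear on \<open>H\<^sup>1\<close>.  As the weak gradient is a chosen representative,
  this amounts to its uniqueness almost everywhere (\<open>weak_gradient_of_zero_AE\<close>): continuously
  differentiable test functions approximate the indicator of any open set, so a weak gradient of
  zero integrates to zero over all open, hence over all measurable, subsets of the domain.\<close>

section \<open>Symmetric forms on spaces of functions\<close>

text \<open>Functions do not carry a vector space instance, so linear algebra is done on sets of
  functions that are closed under \<open>v + c w\<close>.  A single closure law (and a single additivity law
  for forms) covers sums, differences and multiples.\<close>
definition function_space :: "('a \<Rightarrow> real) set \<Rightarrow> bool" where
  "function_space V \<longleftrightarrow> (\<lambda>x. 0) \<in> V \<and> (\<forall>v\<in>V. \<forall>w\<in>V. \<forall>c. (\<lambda>x. v x + c * w x) \<in> V)"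

definition linear_form :: "('a \<Rightarrow> real) set \<Rightarrow> (('a \<Rightarrow> real) \<Rightarrow> real) \<Rightarrow> bool" where
  "linear_form V L \<longleftrightarrow> (\<forall>v\<in>V. \<forall>w\<in>V. \<forall>c. L (\<lambda>x. v x + c * w x) = L v + c * L w)"

definition symmetric_form ::
  "('a \<Rightarrow> real) set \<Rightarrow> (('a \<Rightarrow> real) \<Rightarrow> ('a \<Rightarrow> real) \<Rightarrow> real) \<Rightarrow> bool" where
  "symmetric_form V b \<longleftrightarrow>
     (\<forall>v\<in>V. \<forall>w\<in>V. b v w = b w v) \<and> (\<forall>w\<in>V. linear_form V (\<lambda>v. b v w))"

lemma function_spaceD:
  assumes "function_space V"
  shows "(\<lambda>x. 0) \<in> V" "v \<in> V \<Longrightarrow> w \<in> V \<Longrightarrow> (\<lambda>x. v x + c * w x) \<in> V"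
  using assms by (auto simp: function_space_def)

lemma linear_formD:
  assumes "linear_form V L" "v \<in> V" "w \<in> V"
  shows "L (\<lambda>x. v x + c * w x) = L v + c * L w"
  using assms by (auto simp: linear_form_def)

lemma linear_form_zero:
  assumes "linear_form V L" "function_space V"
  shows "L (\<lambda>x. 0) = 0"
  using linear_formD[OF assms(1), of "\<lambda>x. 0" "\<lambda>x. 0" "-1"] function_spaceD(1)[OF assms(2)] by simp

lemma function_space_scale:
  assumes "function_space V" "v \<in> V"
  shows "(\<lambda>x. c * v x) \<in> V"
  using function_spaceD(2)[OF assms(1) function_spaceD(1)[OF assms(1)] assms(2), of c] by simp

lemma function_space_comb:
  assumes "function_space V" "v \<in> V" "w \<in> V"
  shows "(\<lambda>x. c * v x + d * w x) \<in> V"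
  using function_spaceD(2)[OF assms(1) function_space_scale[OF assms(1,2)] assms(3)] .

lemma linear_form_scale:
  assumes "function_space V" "linear_form V L" "v \<in> V"
  shows "L (\<lambda>x. c * v x) = c * L v"
  using linear_formD[OF assms(2) function_spaceD(1)[OF assms(1)] assms(3), of c]
    linear_form_zero[OF assms(2,1)] by simp

lemma linear_form_comb:
  assumes "function_space V" "linear_form V L" "v \<in> V" "w \<in> V"
  shows "L (\<lambda>x. c * v x + d * w x) = c * L v + d * L w"
  using linear_formD[OF assms(2) function_space_scale[OF assms(1,3), of c] assms(4), of d]
    linear_form_scale[OF assms(1,2,3), of c] by simp

lemma function_space_Int:
  "function_space V \<Longrightarrow> function_space W \<Longrightarrow> function_space (V \<inter> W)"
  by (auto simp: function_space_def)

lemma linear_form_mono: "linear_form V L \<Longrightarrow> W \<subseteq> V \<Longrightarrow> linear_form W L"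
  unfolding linear_form_def by blast

lemma symmetric_form_mono: "symmetric_form V b \<Longrightarrow> W \<subseteq> V \<Longrightarrow> symmetric_form W b"
  unfolding symmetric_form_def by (meson linear_form_mono subsetD)

definition spanned_by :: "'i set \<Rightarrow> ('i \<Rightarrow> 'a \<Rightarrow> real) \<Rightarrow> ('a \<Rightarrow> real) set" where
  "spanned_by I f = {v. \<exists>c. v = (\<lambda>x. \<Sum>i\<in>I. c i * f i x)}"

lemma function_space_spanned_by: "function_space (spanned_by I f)"
proof -
  have "(\<lambda>x. 0) \<in> spanned_by I f"
    unfolding spanned_by_def by (auto intro!: exI[of _ "\<lambda>i. 0"])
  moreover have "(\<lambda>x. (\<Sum>i\<in>I. c i * f i x) + e * (\<Sum>i\<in>I. d i * f i x)) \<in> spanned_by I f" for c d e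
    unfolding spanned_by_def
    by (auto intro!: exI[of _ "\<lambda>i. c i + e * d i"]
        simp: sum.distrib[symmetric] sum_distrib_left algebra_simps)
  ultimately show ?thesis
    unfolding function_space_def by (auto simp: spanned_by_def)
qed

text \<open>Finite dimension enters only through a finite family spanning a set that contains \<open>V\<close>; the
  family itself need not lie in \<open>V\<close>, which suits discontinuous local bases of a space of
  continuous functions.  Existence is a Gram-Schmidt argument by induction on that family: if some
  \<open>e \<in> V\<close> needs the new generator, its \<open>b\<close>-projection onto the smaller space \<open>W\<close> is available by
  the induction hypothesis, so \<open>V\<close> splits \<open>b\<close>-orthogonally into \<open>W\<close> and one line, and the equation
  is solved on both parts separately.\<close>
lemma riesz_finite_dimensional:
  assumes "finite I" "V \<subseteq> spanned_by I f" "function_space V"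
    and "symmetric_form V b" "\<And>v. v \<in> V \<Longrightarrow> v \<noteq> (\<lambda>x. 0) \<Longrightarrow> b v v > 0"
    and "linear_form V L"
  shows "\<exists>!u. u \<in> V \<and> (\<forall>\<phi>\<in>V. b u \<phi> = L \<phi>)"
proof (rule ex_ex1I)
  show "\<exists>u. u \<in> V \<and> (\<forall>\<phi>\<in>V. b u \<phi> = L \<phi>)"
    using assms
  proof (induction I arbitrary: V L rule: finite_induct)
    case empty
    then have "V \<subseteq> {\<lambda>x. 0}" by (auto simp: spanned_by_def)
    moreover have "b (\<lambda>x. 0) (\<lambda>x. 0) = L (\<lambda>x. 0)"
      using empty.prems linear_form_zero function_spaceD(1) unfolding symmetric_form_def by metis
    ultimately show ?case using function_spaceD(1)[OF empty.prems(2)] by auto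
  next
    case (insert j I)
    define W where "W = V \<inter> spanned_by I f"
    note V = insert.prems
    have W: "function_space W" "symmetric_form W b" "\<And>v. v \<in> W \<Longrightarrow> v \<noteq> (\<lambda>x. 0) \<Longrightarrow> b v v > 0"
      "W \<subseteq> spanned_by I f" "W \<subseteq> V"
      using V function_space_Int[OF V(2) function_space_spanned_by] symmetric_form_mono[OF V(3)]
      by (auto simp: W_def)
    have coord: "\<exists>c w. w \<in> spanned_by I f \<and> v = (\<lambda>x. c * f j x + w x)" if v: "v \<in> V" for v
    proof -
      obtain c where c: "v = (\<lambda>x. \<Sum>i\<in>insert j I. c i * f i x)"
        using subsetD[OF V(1) v] unfolding spanned_by_def by blast
      then have "v = (\<lambda>x. c j * f j x + (\<Sum>i\<in>I. c i * f i x))"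
        using insert.hyps by simp
      then show ?thesis unfolding spanned_by_def by blast
    qed
    show ?case
    proof (cases "V \<subseteq> spanned_by I f")
      case True
      then show ?thesis using insert.IH[OF _ V(2-5)] by blast
    next
      case False
      then obtain e c\<^sub>e w\<^sub>e where e: "e \<in> V" "e \<notin> spanned_by I f"
        "w\<^sub>e \<in> spanned_by I f" "e = (\<lambda>x. c\<^sub>e * f j x + w\<^sub>e x)"
        using coord by blast
      then have "c\<^sub>e \<noteq> 0" by auto
      have sym: "b v w = b w v" if "v \<in> V" "w \<in> V" for v w
        using V(3) that by (auto simp: symmetric_form_def)
      have lin: "linear_form V (\<lambda>v. b v w)" if "w \<in> V" for w
        using V(3) that by (auto simp: symmetric_form_def)
      have "linear_form W (\<lambda>v. b v e)"
        using lin[OF e(1)] W(5) by (rule linear_form_mono)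
      then obtain p where p: "p \<in> W" "\<And>w. w \<in> W \<Longrightarrow> b p w = b w e"
        using insert.IH[OF W(4,1,2,3)] by blast
      \<comment> \<open>the component of \<open>e\<close> that is \<open>b\<close>-orthogonal to \<open>W\<close>\<close>
      define e' where "e' = (\<lambda>x. e x + (-1) * p x)"
      have e': "e' \<in> V"
        unfolding e'_def using V(2) e(1) p(1) W(5) by (intro function_spaceD(2)) auto
      have orth: "b e' w = 0" if "w \<in> W" for w
      proof -
        have "b e' w = b e w + (-1) * b p w"
          unfolding e'_def using that p(1) W(5) e(1) by (intro linear_formD[OF lin]) auto
        then show ?thesis using p(2)[OF that] sym[of e w] that W(5) e(1) by auto
      qed
      have "e' \<noteq> (\<lambda>x. 0)"
      proof
        assume "e' = (\<lambda>x. 0)"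
        then have "e = p" by (auto simp: e'_def fun_eq_iff)
        then show False using e(2) p(1) W(4) by auto
      qed
      then have pos: "b e' e' > 0" using V(4) e' by blast
      \<comment> \<open>subtracting the right multiple of \<open>e'\<close> cancels the new generator\<close>
      have decomp: "\<exists>t. (\<lambda>x. v x + (- t) * e' x) \<in> W" if v: "v \<in> V" for v
      proof -
        obtain c w where cw: "w \<in> spanned_by I f" "v = (\<lambda>x. c * f j x + w x)"
          using coord[OF v] by blast
        let ?t = "c / c\<^sub>e"
        have "(\<lambda>x. v x + (- ?t) * e' x) \<in> V"
          using V(2) v e' by (rule function_spaceD(2))
        moreover have "(\<lambda>x. v x + (- ?t) * e' x)
            = (\<lambda>x. (\<lambda>x. w x + (- ?t) * w\<^sub>e x) x + ?t * p x)"
          using \<open>c\<^sub>e \<noteq> 0\<close> by (auto simp: cw(2) e'_def e(4) field_simps)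
        moreover have "(\<lambda>x. (\<lambda>x. w x + (- ?t) * w\<^sub>e x) x + ?t * p x) \<in> spanned_by I f"
          using cw(1) e(3) p(1) W(4)
          by (intro function_spaceD(2)[OF function_space_spanned_by]) auto
        ultimately show ?thesis unfolding W_def by (metis IntI)
      qed
      have "linear_form W L" using V(5) W(5) by (rule linear_form_mono)
      then obtain q where q: "q \<in> W" "\<And>w. w \<in> W \<Longrightarrow> b q w = L w"
        using insert.IH[OF W(4,1,2,3)] by blast
      define s where "s = L e' / b e' e'"
      define u where "u = (\<lambda>x. q x + s * e' x)"
      have u: "u \<in> V" unfolding u_def using V(2) q(1) W(5) e' by (intro function_spaceD(2)) auto
      have bu: "b u w = b q w + s * b e' w" if "w \<in> V" for w
        unfolding u_def using that q(1) W(5) e' by (intro linear_formD[OF lin]) auto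
      have ue: "b u e' = L e'"
        using bu[OF e'] sym[OF _ e', of q] orth[OF q(1)] q(1) W(5) pos by (auto simp: s_def)
      have "b u v = L v" if v: "v \<in> V" for v
      proof -
        obtain t where t: "(\<lambda>x. v x + (- t) * e' x) \<in> W" (is "?w \<in> W")
          using decomp[OF v] by blast
        have "b u ?w = L ?w"
          using bu[of ?w] orth[OF t] q(2)[OF t] t W(5) by auto
        moreover have "b u ?w = b u v + (- t) * b u e'"
          using linear_formD[OF lin[OF u] v e', of "- t"] sym[OF u] t W(5) v e' by auto
        moreover have "L ?w = L v + (- t) * L e'"
          by (rule linear_formD[OF V(5) v e'])
        ultimately show ?thesis using ue by simp
      qed
      then show ?thesis using u by blast
    qed
  qed
next
  fix u v
  assume uv: "u \<in> V \<and> (\<forall>\<phi>\<in>V. b u \<phi> = L \<phi>)" "v \<in> V \<and> (\<forall>\<phi>\<in>V. b v \<phi> = L \<phi>)"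
  let ?d = "\<lambda>x. u x + (-1) * v x"
  have d: "?d \<in> V" using assms(3) uv by (intro function_spaceD(2)) auto
  then have "linear_form V (\<lambda>v. b v ?d)"
    using assms(4) by (auto simp: symmetric_form_def)
  from linear_formD[OF this, of u v "-1"] have "b ?d ?d = 0" using uv d by simp
  then have "?d = (\<lambda>x. 0)" using assms(5)[OF d] by force
  then show "u = v" by (auto simp: fun_eq_iff)
qed

lemma bdf2_mem:
  assumes "function_space V" "w0 \<in> V" "w1 \<in> V" "w2 \<in> V"
  shows "bdf2 w0 w1 w2 \<in> V"
proof -
  have "(\<lambda>x. (3 * w2 x + (-4) * w1 x) + 1 * w0 x) \<in> V"
    using assms by (intro function_spaceD(2) function_space_comb)
  then show ?thesis by (simp add: bdf2_def)
qed

lemma extrap_mem: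
  assumes "function_space V" "w0 \<in> V" "w1 \<in> V"
  shows "extrap w0 w1 \<in> V"
  using function_space_comb[OF assms(1,3,2), of 2 "-1"] by (simp add: extrap_def)

text \<open>The identity
  \<open>2 a (3 a - 4 b + c) = a\<^sup>2 + (2 a - b)\<^sup>2 - b\<^sup>2 - (2 b - c)\<^sup>2 + (a - 2 b + c)\<^sup>2\<close>,
  which makes BDF2 a gradient-stable scheme.  It only uses bilinearity and symmetry, hence serves
  both the Dirichlet form and the \<open>L\<^sup>2\<close> product.\<close>
lemma bdf2_identity:
  assumes V: "function_space V" and b: "symmetric_form V b"
    and w: "w0 \<in> V" "w1 \<in> V" "w2 \<in> V"
  defines "\<delta> \<equiv> (\<lambda>x. w2 x - extrap w0 w1 x)"
  shows "2 * b w2 (bdf2 w0 w1 w2) =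
    b w2 w2 + b (extrap w1 w2) (extrap w1 w2)
    - (b w1 w1 + b (extrap w0 w1) (extrap w0 w1)) + b \<delta> \<delta>"
proof -
  have sym: "b v w = b w v" if "v \<in> V" "w \<in> V" for v w
    using b that by (auto simp: symmetric_form_def)
  have lin: "b (\<lambda>x. c * v x + d * w x) z = c * b v z + d * b w z"
    if "v \<in> V" "w \<in> V" "z \<in> V" for c d v w z
    using b that linear_form_comb[OF V, of "\<lambda>v. b v z"] by (auto simp: symmetric_form_def)
  have lin': "b z (\<lambda>x. c * v x + d * w x) = c * b z v + d * b z w"
    if "v \<in> V" "w \<in> V" "z \<in> V" for c d v w z
    using lin[OF that] sym[OF that(3)] function_space_comb[OF V that(1,2)] that by simp
  have eqs: "bdf2 w0 w1 w2 = (\<lambda>x. 1 * (3 * w2 x + (-4) * w1 x) + 1 * w0 x)"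
    "extrap w0 w1 = (\<lambda>x. 2 * w1 x + (-1) * w0 x)" "extrap w1 w2 = (\<lambda>x. 2 * w2 x + (-1) * w1 x)"
    "\<delta> = (\<lambda>x. 1 * (1 * w2 x + (-2) * w1 x) + 1 * w0 x)"
    by (auto simp: bdf2_def extrap_def \<delta>_def)
  show ?thesis
    unfolding eqs
    by (simp only: lin lin' w function_space_comb[OF V])
      (use sym[OF w(1,2)] sym[OF w(1,3)] sym[OF w(2,3)] in \<open>simp add: algebra_simps\<close>)
qed

section \<open>Approximating open sets by test functions\<close>

lemma DERIV_pos_part_square:
  "DERIV (\<lambda>s::real. (max 0 s)\<^sup>2) s :> 2 * max 0 s"
proof -
  consider "s > 0" | "s < 0" | "s = 0" by linarith
  then show ?thesis
  proof cases
    case 1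
    have "DERIV (\<lambda>s::real. s\<^sup>2) s :> 2 * max 0 s"
      using 1 by (auto intro!: derivative_eq_intros)
    moreover have "\<forall>\<^sub>F t in nhds s. (max 0 t)\<^sup>2 = t\<^sup>2"
      using eventually_nhds_in_open[of "{0<..}" s] 1 by (auto elim!: eventually_mono)
    ultimately show ?thesis by (subst DERIV_cong_ev[OF refl _ refl]) auto
  next
    case 2
    have "DERIV (\<lambda>s::real. 0) s :> 2 * max 0 s"
      using 2 by simp
    moreover have "\<forall>\<^sub>F t in nhds s. (max 0 t)\<^sup>2 = 0"
      using eventually_nhds_in_open[of "{..<0}" s] 2 by (auto elim!: eventually_mono)
    ultimately show ?thesis by (subst DERIV_cong_ev[OF refl _ refl]) auto
  next
    case 3
    have "((\<lambda>h::real. max 0 h) \<longlongrightarrow> max 0 0) (at 0)"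
      by (intro tendsto_intros)
    then have "((\<lambda>h::real. max 0 h) \<longlongrightarrow> 0) (at 0)"
      by simp
    then have "((\<lambda>h::real. ((max 0 (0 + h))\<^sup>2 - (max 0 0)\<^sup>2) / h) \<longlongrightarrow> 0) (at 0)"
      by (rule Lim_transform_eventually)
        (auto simp: eventually_at_filter max_def power2_eq_square)
    then show ?thesis using 3 by (simp add: DERIV_def)
  qed
qed

text \<open>The square of the positive part makes \<open>bump c r\<close> continuously differentiable across the sphere,
  as smooth as the test functions have to be.\<close>
definition bump :: "'a::real_inner \<Rightarrow> real \<Rightarrow> 'a \<Rightarrow> real" where
  "bump c r x = (max 0 (r\<^sup>2 - (x - c) \<bullet> (x - c)))\<^sup>2"

definition bump_grad :: "'a::real_inner \<Rightarrow> real \<Rightarrow> 'a \<Rightarrow> 'a" where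
  "bump_grad c r x = (2 * max 0 (r\<^sup>2 - (x - c) \<bullet> (x - c))) *\<^sub>R ((-2) *\<^sub>R (x - c))"

lemma GDERIV_bump: "GDERIV (bump c r) x :> bump_grad c r x"
proof -
  have "GDERIV (\<lambda>x. r\<^sup>2 - (x - c) \<bullet> (x - c)) x :> (-2) *\<^sub>R (x - c)"
    unfolding gderiv_def
    by (auto intro!: derivative_eq_intros simp: inner_commute algebra_simps)
  from GDERIV_DERIV_compose[OF this DERIV_pos_part_square]
  show ?thesis unfolding bump_def[abs_def] bump_grad_def .
qed

lemma continuous_on_bump_grad: "continuous_on UNIV (bump_grad c r)"
  unfolding bump_grad_def[abs_def] by (intro continuous_intros)

lemma bump_nonneg: "0 \<le> bump c r x"
  by (simp add: bump_def)

lemma bump_pos_iff: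
  assumes "r > 0"
  shows "bump c r x > 0 \<longleftrightarrow> x \<in> ball c r"
proof -
  have "bump c r x > 0 \<longleftrightarrow> (norm (x - c))\<^sup>2 < r\<^sup>2"
    by (auto simp: bump_def power2_norm_eq_inner max_def)
  also have "\<dots> \<longleftrightarrow> x \<in> ball c r"
    using assms by (auto simp: dist_norm norm_minus_commute
        intro: power_strict_mono dest: power_less_imp_less_base)
  finally show ?thesis .
qed

lemma open_eq_countable_balls:
  fixes S :: "'a::euclidean_space set"
  assumes "open S" "S \<noteq> {}"
  obtains c :: "nat \<Rightarrow> 'a" and r :: "nat \<Rightarrow> real"
  where "\<And>i. r i > 0" "\<And>i. cball (c i) (r i) \<subseteq> S" "S = (\<Union>i. ball (c i) (r i))"
proof -
  define P where "P = {p::'a \<times> real. snd p > 0 \<and> cball (fst p) (snd p) \<subseteq> S}"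
  define \<F> where "\<F> = (\<lambda>p. ball (fst p) (snd p)) ` P"
  have "\<And>X. X \<in> \<F> \<Longrightarrow> open X" by (auto simp: \<F>_def)
  then obtain \<F>' where F': "\<F>' \<subseteq> \<F>" "countable \<F>'" "\<Union>\<F>' = \<Union>\<F>"
    by (rule Lindelof)
  have U: "\<Union>\<F> = S"
  proof
    show "\<Union>\<F> \<subseteq> S" by (force simp: \<F>_def P_def)
    show "S \<subseteq> \<Union>\<F>"
    proof
      fix x assume "x \<in> S"
      then obtain e where "e > 0" "cball x e \<subseteq> S"
        using \<open>open S\<close> open_contains_cball by blast
      then have "(x, e) \<in> P" "x \<in> ball x e" by (auto simp: P_def)
      then show "x \<in> \<Union>\<F>" by (force simp: \<F>_def)
    qed
  qed
  from F' obtain Q where Q: "Q \<subseteq> P" "countable Q" "\<F>' = (\<lambda>p. ball (fst p) (snd p)) ` Q"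
    unfolding \<F>_def by (meson countable_subset_image)
  have ne: "Q \<noteq> {}" using F' U Q assms by auto
  define p where "p = from_nat_into Q"
  have r: "range p = Q" unfolding p_def by (rule range_from_nat_into[OF ne Q(2)])
  show thesis
  proof (rule that[of "\<lambda>i. snd (p i)" "\<lambda>i. fst (p i)"])
    fix i
    have "p i \<in> P" using r Q by blast
    then show "snd (p i) > 0" "cball (fst (p i)) (snd (p i)) \<subseteq> S" by (auto simp: P_def)
  next
    have "S = (\<Union>q\<in>Q. ball (fst q) (snd q))" using U F' Q by auto
    also have "\<dots> = (\<Union>i. ball (fst (p i)) (snd (p i)))" unfolding r[symmetric] by auto
    finally show "S = \<dots>" .
  qed
qed

text \<open>The admissible pairs in the definition of weak gradients.\<close>
definition test_function :: "(real^'d) set \<Rightarrow> (real^'d \<Rightarrow> real) \<Rightarrow> (real^'d \<Rightarrow> real^'d) \<Rightarrow> bool" where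
  "test_function \<Omega> \<phi> D \<longleftrightarrow> (\<forall>x. GDERIV \<phi> x :> D x) \<and> continuous_on UNIV D \<and>
        (\<exists>K. compact K \<and> K \<subseteq> \<Omega> \<and> (\<forall>x. x \<notin> K \<longrightarrow> \<phi> x = 0))"

text \<open>Exhaust \<open>S\<close> by countably many balls whose closures stay inside \<open>S\<close>, and let \<open>w\<close> be \<open>N\<close> times
  the sum of the first \<open>N\<close> bumps.  Then \<open>w\<close> tends to infinity on \<open>S\<close> and vanishes elsewhere, so
  \<open>w / (1 + w)\<close> tends to the indicator of \<open>S\<close> while keeping compact support.\<close>
lemma test_functions_approximate_open_set:
  fixes S \<Omega> :: "(real^'d) set"
  assumes "open S" "S \<subseteq> \<Omega>"
  obtains \<phi> D where "\<And>N. test_function \<Omega> (\<phi> N) (D N)" "\<And>N x. \<phi> N x \<in> {0..1}"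
    "\<And>x. (\<lambda>N. \<phi> N x) \<longlonglongrightarrow> indicator S x"
proof (cases "S = {}")
  case True
  have "test_function \<Omega> (\<lambda>x. 0) (\<lambda>x. 0)"
    unfolding test_function_def
    by (intro conjI exI[of _ "{}"] allI GDERIV_const continuous_on_const) simp_all
  then show thesis
    using that[of "\<lambda>N x. 0" "\<lambda>N x. 0"] by (simp add: True)
next
  case False
  obtain r :: "nat \<Rightarrow> real" and c :: "nat \<Rightarrow> real^'d"
    where cr: "\<And>i. r i > 0" "\<And>i. cball (c i) (r i) \<subseteq> S" "S = (\<Union>i. ball (c i) (r i))"
    using open_eq_countable_balls[OF assms(1) False] by metis
  define w where "w N x = real N * (\<Sum>i<N. bump (c i) (r i) x)" for N x
  define G where "G N x = real N *\<^sub>R (\<Sum>i<N. bump_grad (c i) (r i) x)" for N x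
  define \<phi> where "\<phi> N x = w N x * inverse (1 + w N x)" for N x
  define D where "D N x = inverse ((1 + w N x)\<^sup>2) *\<^sub>R G N x" for N x
  have w0: "0 \<le> w N x" for N x by (auto simp: w_def intro!: mult_nonneg_nonneg sum_nonneg bump_nonneg)
  have sumD: "GDERIV (\<lambda>x. \<Sum>i<N. bump (c i) (r i) x) x :> (\<Sum>i<N. bump_grad (c i) (r i) x)" for N x
    by (induction N) (auto intro: GDERIV_const GDERIV_add GDERIV_bump)
  have wD: "GDERIV (w N) x :> G N x" for N x
    using GDERIV_mult[OF GDERIV_const[where k="real N"] sumD[of N x]]
    by (simp add: w_def[abs_def] G_def)
  have Gc: "continuous_on UNIV (G N)" for N
    unfolding G_def[abs_def] by (intro continuous_intros continuous_on_bump_grad)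
  have wc: "continuous_on UNIV (w N)" for N
    unfolding w_def[abs_def] bump_def by (intro continuous_intros)
  have ne: "1 + w N x \<noteq> 0" for N x using w0[of N x] by linarith
  have D: "GDERIV (\<phi> N) x :> D N x" for N x
  proof -
    have "DERIV (\<lambda>s. s * inverse (1 + s)) (w N x) :> inverse ((1 + w N x)\<^sup>2)"
      using ne[of N x] by (auto intro!: derivative_eq_intros simp: field_simps power2_eq_square)
    from GDERIV_DERIV_compose[OF wD this] show ?thesis
      unfolding \<phi>_def[abs_def] D_def .
  qed
  have Dc: "continuous_on UNIV (D N)" for N
    unfolding D_def[abs_def] using ne by (intro continuous_intros Gc wc) auto
  have pos: "bump (c i) (r i) x = 0 \<longleftrightarrow> x \<notin> ball (c i) (r i)" for i x
    using bump_pos_iff[OF cr(1)[of i], of "c i" x] bump_nonneg[of "c i" "r i" x] by linarith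
  show thesis
  proof (rule that[of \<phi> D])
    fix N
    let ?K = "\<Union>i<N. cball (c i) (r i)"
    have "compact ?K" by (intro compact_UN) auto
    moreover have "?K \<subseteq> \<Omega>" using cr(2) assms(2) by blast
    moreover have "\<phi> N x = 0" if "x \<notin> ?K" for x
    proof -
      have "bump (c i) (r i) x = 0" if "i < N" for i
        using \<open>x \<notin> ?K\<close> that unfolding pos by force
      then show ?thesis by (simp add: \<phi>_def w_def)
    qed
    ultimately show "test_function \<Omega> (\<phi> N) (D N)"
      unfolding test_function_def using D Dc by blast
    show "\<phi> N x \<in> {0..1}" for x
      using w0[of N x] by (auto simp: \<phi>_def field_simps)
  next
    fix x
    show "(\<lambda>N. \<phi> N x) \<longlonglongrightarrow> indicator S x"
    proof (cases "x \<in> S")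
      case False
      then have "bump (c i) (r i) x = 0" for i unfolding pos cr(3) by auto
      then show ?thesis using False by (simp add: \<phi>_def w_def)
    next
      case True
      then obtain j where j: "x \<in> ball (c j) (r j)" using cr(3) by auto
      define b where "b = bump (c j) (r j) x"
      have b: "b > 0" using bump_pos_iff[OF cr(1)] j by (auto simp: b_def)
      have wge: "real N * b \<le> w N x" if "N > j" for N
        unfolding w_def b_def using that
        by (intro mult_left_mono member_le_sum) (auto simp: bump_nonneg)
      have "filterlim (\<lambda>N. real N * b) at_top sequentially"
        using filterlim_tendsto_pos_mult_at_top[OF tendsto_const b filterlim_real_sequentially]
        by (simp add: mult.commute)
      then have "filterlim (\<lambda>N. w N x) at_top sequentially"
        by (rule filterlim_at_top_mono)
          (use wge in \<open>auto intro: eventually_mono[OF eventually_gt_at_top[of j]]\<close>)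
      then have "filterlim (\<lambda>N. 1 + w N x) at_infinity sequentially"
        by (intro filterlim_at_top_imp_at_infinity filterlim_tendsto_add_at_top[OF tendsto_const])
      from tendsto_diff[OF tendsto_const[of 1] tendsto_inverse_0[THEN filterlim_compose, OF this]]
      have "(\<lambda>N. 1 - inverse (1 + w N x)) \<longlonglongrightarrow> 1" by simp
      moreover have "1 - inverse (1 + w N x) = \<phi> N x" for N
        using ne[of N x] by (simp add: \<phi>_def field_simps)
      ultimately show ?thesis using True by simp
    qed
  qed
qed

text \<open>Open sets are stable under intersection and generate the Borel sets, so a Dynkin argument carries
  the vanishing of the integrals to all Borel sets, and completion to all Lebesgue sets.\<close>
lemma AE_zero_if_open_integrals_zero:
  fixes g :: "'a::euclidean_space \<Rightarrow> 'b::euclidean_space"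
  assumes "open \<Omega>" "bounded \<Omega>" and g: "integrable (lebesgue_on \<Omega>) g"
    and zero: "\<And>S. open S \<Longrightarrow> S \<subseteq> \<Omega> \<Longrightarrow> (LINT x|lebesgue_on \<Omega>. indicator S x *\<^sub>R g x) = 0"
  shows "AE x in lebesgue_on \<Omega>. g x = 0"
proof -
  let ?M = "lebesgue_on \<Omega>"
  have \<Omega>: "\<Omega> \<in> sets lebesgue" using assms(1) by auto
  interpret finite_measure ?M
    using assms(1,2) by (intro finite_measure_lebesgue_on lmeasurable_open)
  have borel_sets: "A \<inter> \<Omega> \<in> sets ?M" if "A \<in> sets borel" for A
    using that \<Omega> by (auto simp: sets_restrict_space intro!: image_eqI[of _ _ A])
  have int: "integrable ?M (\<lambda>x. indicator A x *\<^sub>R g x)" if "A \<in> sets borel" for A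
  proof -
    have "integrable ?M (\<lambda>x. indicator (A \<inter> \<Omega>) x *\<^sub>R g x)"
      using borel_sets[OF that] g by (rule integrable_mult_indicator)
    then show ?thesis
      by (rule Bochner_Integration.integrable_cong[THEN iffD1, rotated 2]) (auto simp: indicator_def)
  qed
  have total: "(LINT x|?M. g x) = 0"
  proof -
    have "(LINT x|?M. g x) = (LINT x|?M. indicator \<Omega> x *\<^sub>R g x)"
      by (intro Bochner_Integration.integral_cong) auto
    then show ?thesis using zero[OF assms(1)] by simp
  qed
  have borel: "(LINT x|?M. indicator A x *\<^sub>R g x) = 0" if "A \<in> sets borel" for A
  proof -
    have "Int_stable {S::'a set. open S}" "{S::'a set. open S} \<subseteq> Pow UNIV"
      "A \<in> sigma_sets UNIV {S. open S}" using that by (auto simp: borel_def Int_stable_def)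
    then show ?thesis
    proof (induction A rule: sigma_sets_induct_disjoint)
      case (basic A)
      have "(LINT x|?M. indicator A x *\<^sub>R g x) = (LINT x|?M. indicator (A \<inter> \<Omega>) x *\<^sub>R g x)"
        by (intro Bochner_Integration.integral_cong) (auto simp: indicator_def)
      then show ?case using zero[of "A \<inter> \<Omega>"] basic assms(1) by auto
    next
      case empty
      then show ?case by simp
    next
      case (compl A)
      then have "A \<in> sets borel" by (simp add: borel_def)
      have "(LINT x|?M. indicator (UNIV - A) x *\<^sub>R g x) = (LINT x|?M. g x - indicator A x *\<^sub>R g x)"
        by (intro Bochner_Integration.integral_cong) (auto simp: indicator_def)
      also have "\<dots> = 0" using compl total int[OF \<open>A \<in> sets borel\<close>] g by simp
      finally show ?case .
    next
      case (union A)
      then have A: "A i \<in> sets borel" for i by (auto simp: borel_def)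
      have "(LINT x|?M. indicator (\<Union>i. A i \<inter> \<Omega>) x *\<^sub>R g x) = (\<Sum>i. LINT x|?M. indicator (A i \<inter> \<Omega>) x *\<^sub>R g x)"
      proof (rule lebesgue_integral_countable_add[where M = ?M and A = "\<lambda>i. A i \<inter> \<Omega>" and f = g, unfolded set_lebesgue_integral_def])
        show "A i \<inter> \<Omega> \<inter> (A j \<inter> \<Omega>) = {}" if "i \<noteq> j" for i j
          using union that by (auto simp: disjoint_family_on_def)
        show "set_integrable ?M (\<Union>i. A i \<inter> \<Omega>) g"
          unfolding set_integrable_def using borel_sets A g
          by (intro integrable_mult_indicator) auto
      qed (use A borel_sets in auto)
      also have "(LINT x|?M. indicator (\<Union>i. A i \<inter> \<Omega>) x *\<^sub>R g x) = (LINT x|?M. indicator (\<Union>i. A i) x *\<^sub>R g x)"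
        by (intro Bochner_Integration.integral_cong) (auto simp: indicator_def)
      also have "(\<lambda>i. LINT x|?M. indicator (A i \<inter> \<Omega>) x *\<^sub>R g x) = (\<lambda>i. 0)"
      proof
        fix i
        have "(LINT x|?M. indicator (A i \<inter> \<Omega>) x *\<^sub>R g x) = (LINT x|?M. indicator (A i) x *\<^sub>R g x)"
          by (intro Bochner_Integration.integral_cong) (auto simp: indicator_def)
        then show "(LINT x|?M. indicator (A i \<inter> \<Omega>) x *\<^sub>R g x) = 0" using union by auto
      qed
      finally show ?case by simp
    qed
  qed
  show ?thesis
  proof (rule density_zero[OF g])
    fix A assume "A \<in> sets ?M"
    then have A: "A \<in> sets lebesgue" "A \<subseteq> \<Omega>"
      using \<Omega> by (auto simp: sets_restrict_space_iff)
    from sets_lebesgue_almost_borel[OF A(1)] obtain B N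
      where BN: "B \<in> sets borel" "negligible N" "B \<union> N = A" by blast
    have "AE x in ?M. x \<notin> N"
      using BN(2) \<Omega> by (auto simp: negligible_iff_null_sets AE_restrict_space_iff dest: AE_not_in)
    then have "AE x in ?M. indicator A x *\<^sub>R g x = indicator B x *\<^sub>R g x"
      by eventually_elim (use BN(3) in \<open>auto simp: indicator_def\<close>)
    moreover have "(\<lambda>x. indicator A x *\<^sub>R g x) \<in> borel_measurable ?M"
      using integrable_mult_indicator[OF \<open>A \<in> sets ?M\<close> g] by auto
    moreover have "(\<lambda>x. indicator B x *\<^sub>R g x) \<in> borel_measurable ?M"
      using int[OF BN(1)] by auto
    ultimately have "(LINT x|?M. indicator A x *\<^sub>R g x) = (LINT x|?M. indicator B x *\<^sub>R g x)"
      by (intro integral_cong_AE)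
    then show "set_lebesgue_integral ?M A g = 0"
      unfolding set_lebesgue_integral_def using borel[OF BN(1)] by simp
  qed
qed

section \<open>Square integrable functions and weak gradients\<close>

locale bounded_open_set =
  fixes \<Omega> :: "(real^'d) set"
  assumes open_domain: "open \<Omega>" and bounded_domain: "bounded \<Omega>"
begin

lemma domain_lmeasurable: "\<Omega> \<in> lmeasurable"
  using open_domain bounded_domain by (intro lmeasurable_open)

lemma finite_measure_domain: "finite_measure (lebesgue_on \<Omega>)"
  by (rule finite_measure_lebesgue_on[OF domain_lmeasurable])

lemma integrable_bounded_continuous:
  fixes f :: "real^'d \<Rightarrow> 'b::euclidean_space"
  assumes "continuous_on (closure \<Omega>) f"
  shows "f \<in> borel_measurable (lebesgue_on \<Omega>)" "\<exists>C. \<forall>x\<in>\<Omega>. norm (f x) \<le> C"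
    "integrable (lebesgue_on \<Omega>) f"
proof -
  show m: "f \<in> borel_measurable (lebesgue_on \<Omega>)"
    using continuous_on_subset[OF assms closure_subset] open_domain
    by (intro continuous_imp_measurable_on_sets_lebesgue) auto
  have "compact (f ` closure \<Omega>)"
    using assms bounded_domain by (intro compact_continuous_image) (auto simp: compact_closure)
  then obtain C where "\<forall>y\<in>f ` closure \<Omega>. norm y \<le> C"
    using compact_imp_bounded bounded_iff by metis
  then show C: "\<exists>C. \<forall>x\<in>\<Omega>. norm (f x) \<le> C"
    using closure_subset[of \<Omega>] by blast
  then show "integrable (lebesgue_on \<Omega>) f"
    using m finite_measure.integrable_const_bound[OF finite_measure_domain, of f]
    by (metis AE_I2 space_lebesgue_on)
qed

lemma L2_measurable: "f \<in> L2 \<Omega> \<Longrightarrow> f \<in> borel_measurable (lebesgue_on \<Omega>)"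
  by (simp add: L2_def)

lemma integrable_dominated_by_squares:
  fixes f g :: "real^'d \<Rightarrow> 'b::euclidean_space" and h :: "real^'d \<Rightarrow> 'c::euclidean_space"
  assumes "f \<in> L2 \<Omega>" "g \<in> L2 \<Omega>" "h \<in> borel_measurable (lebesgue_on \<Omega>)"
    and "\<And>x. norm (h x) \<le> C * ((norm (f x))\<^sup>2 + (norm (g x))\<^sup>2)"
  shows "integrable (lebesgue_on \<Omega>) h"
proof (rule Bochner_Integration.integrable_bound)
  show "integrable (lebesgue_on \<Omega>) (\<lambda>x. C * ((norm (f x))\<^sup>2 + (norm (g x))\<^sup>2))"
    using assms(1,2) by (auto simp: L2_def)
  show "AE x in lebesgue_on \<Omega>. norm (h x) \<le> norm (C * ((norm (f x))\<^sup>2 + (norm (g x))\<^sup>2))"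
  proof (rule AE_I2)
    fix x
    show "norm (h x) \<le> norm (C * ((norm (f x))\<^sup>2 + (norm (g x))\<^sup>2))"
      using assms(4)[of x] by simp
  qed
qed (use assms in auto)

lemma L2_comb:
  fixes f g :: "real^'d \<Rightarrow> 'b::euclidean_space"
  assumes "f \<in> L2 \<Omega>" "g \<in> L2 \<Omega>"
  shows "(\<lambda>x. f x + c *\<^sub>R g x) \<in> L2 \<Omega>"
proof -
  have m: "(\<lambda>x. f x + c *\<^sub>R g x) \<in> borel_measurable (lebesgue_on \<Omega>)"
    using assms[THEN L2_measurable] by measurable
  have "(norm (f x + c *\<^sub>R g x))\<^sup>2 \<le> (2 + 2 * c\<^sup>2) * ((norm (f x))\<^sup>2 + (norm (g x))\<^sup>2)" for x
  proof -
    have "(norm (f x + c *\<^sub>R g x))\<^sup>2 \<le> (norm (f x) + \<bar>c\<bar> * norm (g x))\<^sup>2"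
      using norm_triangle_ineq[of "f x" "c *\<^sub>R g x"] by (intro power_mono) auto
    also have "\<dots> \<le> 2 * (norm (f x))\<^sup>2 + 2 * (\<bar>c\<bar> * norm (g x))\<^sup>2"
      using sum_squares_bound[of "norm (f x)" "\<bar>c\<bar> * norm (g x)"] by (simp add: power2_sum)
    also have "\<dots> \<le> (2 + 2 * c\<^sup>2) * ((norm (f x))\<^sup>2 + (norm (g x))\<^sup>2)"
      by (simp add: algebra_simps power_mult_distrib)
    finally show ?thesis .
  qed
  then have "integrable (lebesgue_on \<Omega>) (\<lambda>x. (norm (f x + c *\<^sub>R g x))\<^sup>2)"
    using m by (intro integrable_dominated_by_squares[OF assms]) auto
  then show ?thesis using m by (simp add: L2_def)
qed

lemma integrable_inner_L2:
  fixes f g :: "real^'d \<Rightarrow> 'b::euclidean_space"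
  assumes "f \<in> L2 \<Omega>" "g \<in> L2 \<Omega>"
  shows "integrable (lebesgue_on \<Omega>) (\<lambda>x. f x \<bullet> g x)"
proof (rule integrable_dominated_by_squares[OF assms, where C=1])
  show "(\<lambda>x. f x \<bullet> g x) \<in> borel_measurable (lebesgue_on \<Omega>)"
    using assms[THEN L2_measurable] by (rule borel_measurable_inner)
  fix x
  have "norm (f x \<bullet> g x) \<le> norm (f x) * norm (g x)"
    using Cauchy_Schwarz_ineq2[of "f x" "g x"] by simp
  also have "\<dots> \<le> (norm (f x))\<^sup>2 + (norm (g x))\<^sup>2"
    using sum_squares_bound[of "norm (f x)" "norm (g x)"]
      mult_nonneg_nonneg[OF norm_ge_zero[of "f x"] norm_ge_zero[of "g x"]] by linarith
  finally show "norm (f x \<bullet> g x) \<le> 1 * ((norm (f x))\<^sup>2 + (norm (g x))\<^sup>2)" by simp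
qed

lemma function_space_L2: "function_space (L2 \<Omega> :: (real^'d \<Rightarrow> real) set)"
  unfolding function_space_def using L2_comb[where 'b = real] by (auto simp: L2_def)

lemma l2_inner_symmetric_form: "symmetric_form (L2 \<Omega>) (l2_inner \<Omega>)"
proof -
  have "l2_inner \<Omega> (\<lambda>x. v x + c * w x) z = l2_inner \<Omega> v z + c * l2_inner \<Omega> w z"
    if "v \<in> L2 \<Omega>" "w \<in> L2 \<Omega>" "z \<in> L2 \<Omega>" for v w z c
    using integrable_inner_L2[OF that(1,3)] integrable_inner_L2[OF that(2,3)]
    by (simp add: l2_inner_def distrib_right mult.assoc)
  then show ?thesis
    by (auto simp: symmetric_form_def linear_form_def l2_inner_def mult.commute)
qed

lemma L2_integrable:
  fixes f :: "real^'d \<Rightarrow> 'b::euclidean_space"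
  assumes "f \<in> L2 \<Omega>"
  shows "integrable (lebesgue_on \<Omega>) f"
proof (rule Bochner_Integration.integrable_bound)
  interpret finite_measure "lebesgue_on \<Omega>" by (rule finite_measure_domain)
  show "integrable (lebesgue_on \<Omega>) (\<lambda>x. 1 + (norm (f x))\<^sup>2)"
    using assms by (auto simp: L2_def)
  show "AE x in lebesgue_on \<Omega>. norm (f x) \<le> norm (1 + (norm (f x))\<^sup>2)"
  proof (rule AE_I2)
    fix x
    show "norm (f x) \<le> norm (1 + (norm (f x))\<^sup>2)"
      using sum_squares_bound[of 1 "norm (f x)"] norm_ge_zero[of "f x"]
      by (simp del: norm_ge_zero)
  qed
qed (use assms in \<open>auto dest: L2_measurable\<close>)

lemma integrable_continuous_scaleR_left:
  fixes f :: "real^'d \<Rightarrow> real" and g :: "real^'d \<Rightarrow> 'b::euclidean_space"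
  assumes "continuous_on (closure \<Omega>) f" "integrable (lebesgue_on \<Omega>) g"
  shows "integrable (lebesgue_on \<Omega>) (\<lambda>x. f x *\<^sub>R g x)"
proof -
  obtain C where C: "\<forall>x\<in>\<Omega>. norm (f x) \<le> C"
    using integrable_bounded_continuous(2)[OF assms(1)] by blast
  show ?thesis
  proof (rule Bochner_Integration.integrable_bound)
    show "integrable (lebesgue_on \<Omega>) (\<lambda>x. C * norm (g x))" using assms(2) by auto
    show "AE x in lebesgue_on \<Omega>. norm (f x *\<^sub>R g x) \<le> norm (C * norm (g x))"
    proof (rule AE_I2)
      fix x assume "x \<in> space (lebesgue_on \<Omega>)"
      then have "\<bar>f x\<bar> \<le> \<bar>C\<bar>" using C by fastforce
      then show "norm (f x *\<^sub>R g x) \<le> norm (C * norm (g x))"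
        by (simp add: abs_mult mult_right_mono)
    qed
  qed (use assms integrable_bounded_continuous(1)[OF assms(1)] in auto)
qed

lemma integrable_continuous_scaleR_right:
  fixes f :: "real^'d \<Rightarrow> real" and g :: "real^'d \<Rightarrow> 'b::euclidean_space"
  assumes "integrable (lebesgue_on \<Omega>) f" "continuous_on (closure \<Omega>) g"
  shows "integrable (lebesgue_on \<Omega>) (\<lambda>x. f x *\<^sub>R g x)"
proof -
  obtain C where C: "\<forall>x\<in>\<Omega>. norm (g x) \<le> C"
    using integrable_bounded_continuous(2)[OF assms(2)] by blast
  show ?thesis
  proof (rule Bochner_Integration.integrable_bound)
    show "integrable (lebesgue_on \<Omega>) (\<lambda>x. C * norm (f x))" using assms(1) by auto
    show "AE x in lebesgue_on \<Omega>. norm (f x *\<^sub>R g x) \<le> norm (C * norm (f x))"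
    proof (rule AE_I2)
      fix x assume "x \<in> space (lebesgue_on \<Omega>)"
      then have "norm (g x) \<le> \<bar>C\<bar>" using C by fastforce
      then show "norm (f x *\<^sub>R g x) \<le> norm (C * norm (f x))"
        by (simp add: abs_mult mult_right_mono mult.commute[of "\<bar>f x\<bar>"])
    qed
  qed (use assms integrable_bounded_continuous(1)[OF assms(2)] in auto)
qed

lemma has_weak_gradient_alt:
  "has_weak_gradient \<Omega> v g \<longleftrightarrow> (\<forall>\<phi> D. test_function \<Omega> \<phi> D \<longrightarrow>
     (LINT x|lebesgue_on \<Omega>. v x *\<^sub>R D x) = - (LINT x|lebesgue_on \<Omega>. \<phi> x *\<^sub>R g x))"
  by (auto simp: has_weak_gradient_def test_function_def)

lemma test_function_continuous:
  assumes "test_function \<Omega> \<phi> D"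
  shows "continuous_on S \<phi>" "continuous_on S D"
proof -
  have "isCont \<phi> x" for x
    using assms has_derivative_continuous unfolding test_function_def gderiv_def by blast
  then show "continuous_on S \<phi>" by (simp add: continuous_at_imp_continuous_on)
  show "continuous_on S D"
    using assms continuous_on_subset unfolding test_function_def by blast
qed

lemma has_weak_gradient_comb:
  assumes "v \<in> L2 \<Omega>" "w \<in> L2 \<Omega>" "g \<in> L2 \<Omega>" "h \<in> L2 \<Omega>"
    and "has_weak_gradient \<Omega> v g" "has_weak_gradient \<Omega> w h"
  shows "has_weak_gradient \<Omega> (\<lambda>x. v x + c * w x) (\<lambda>x. g x + c *\<^sub>R h x)"
  unfolding has_weak_gradient_alt
proof (intro allI impI)
  fix \<phi> D assume t: "test_function \<Omega> \<phi> D"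
  note tc = test_function_continuous[OF t, of "closure \<Omega>"]
  note ir = integrable_continuous_scaleR_right[OF L2_integrable tc(2)]
  note il = integrable_continuous_scaleR_left[OF tc(1) L2_integrable]
  have "(LINT x|lebesgue_on \<Omega>. (v x + c * w x) *\<^sub>R D x)
      = (LINT x|lebesgue_on \<Omega>. v x *\<^sub>R D x + c *\<^sub>R (w x *\<^sub>R D x))"
    by (simp add: scaleR_add_left)
  also have "\<dots> = (LINT x|lebesgue_on \<Omega>. v x *\<^sub>R D x) + c *\<^sub>R (LINT x|lebesgue_on \<Omega>. w x *\<^sub>R D x)"
    using ir[OF assms(1)] ir[OF assms(2)]
    by (subst Bochner_Integration.integral_add) (auto simp del: scaleR_scaleR)
  also have "\<dots> = - ((LINT x|lebesgue_on \<Omega>. \<phi> x *\<^sub>R g x) + c *\<^sub>R (LINT x|lebesgue_on \<Omega>. \<phi> x *\<^sub>R h x))"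
    using assms(5,6) t unfolding has_weak_gradient_alt by simp
  also have "(LINT x|lebesgue_on \<Omega>. \<phi> x *\<^sub>R g x) + c *\<^sub>R (LINT x|lebesgue_on \<Omega>. \<phi> x *\<^sub>R h x)
      = (LINT x|lebesgue_on \<Omega>. \<phi> x *\<^sub>R g x + c *\<^sub>R (\<phi> x *\<^sub>R h x))"
    using il[OF assms(3)] il[OF assms(4)]
    by (subst Bochner_Integration.integral_add) (auto simp del: scaleR_scaleR)
  also have "\<dots> = (LINT x|lebesgue_on \<Omega>. \<phi> x *\<^sub>R (g x + c *\<^sub>R h x))"
    by (simp add: scaleR_add_right mult.commute)
  finally show "(LINT x|lebesgue_on \<Omega>. (v x + c * w x) *\<^sub>R D x)
      = - (LINT x|lebesgue_on \<Omega>. \<phi> x *\<^sub>R (g x + c *\<^sub>R h x))" .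
qed

text \<open>The fundamental lemma of the calculus of variations: the pairing of \<open>g\<close> with every test
  function vanishes, and test functions approximate indicators of open sets boundedly.\<close>
lemma weak_gradient_of_zero_AE:
  assumes g: "g \<in> L2 \<Omega>" and "has_weak_gradient \<Omega> (\<lambda>x. 0) g"
  shows "AE x in lebesgue_on \<Omega>. g x = 0"
proof (rule AE_zero_if_open_integrals_zero[OF open_domain bounded_domain L2_integrable[OF g]])
  fix S assume S: "open S" "S \<subseteq> \<Omega>"
  obtain \<phi> D where t: "\<And>N. test_function \<Omega> (\<phi> N) (D N)" "\<And>N x. \<phi> N x \<in> {0..1}"
    "\<And>x. (\<lambda>N::nat. \<phi> N x) \<longlonglongrightarrow> indicator S x"
    using test_functions_approximate_open_set[OF S] by metis
  have zero: "(LINT x|lebesgue_on \<Omega>. \<phi> N x *\<^sub>R g x) = 0" for N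
    using assms(2) t(1)[of N] by (auto simp: has_weak_gradient_alt)
  have "(\<lambda>N. LINT x|lebesgue_on \<Omega>. \<phi> N x *\<^sub>R g x)
      \<longlonglongrightarrow> (LINT x|lebesgue_on \<Omega>. indicator S x *\<^sub>R g x)"
  proof (rule integral_dominated_convergence)
    show "integrable (lebesgue_on \<Omega>) (\<lambda>x. norm (g x))"
      using L2_integrable[OF g] by auto
    show "(\<lambda>x. \<phi> N x *\<^sub>R g x) \<in> borel_measurable (lebesgue_on \<Omega>)" for N
      using integrable_continuous_scaleR_left[OF test_function_continuous(1)[OF t(1)] L2_integrable[OF g]]
      by auto
    show "AE x in lebesgue_on \<Omega>. (\<lambda>N. \<phi> N x *\<^sub>R g x) \<longlonglongrightarrow> indicator S x *\<^sub>R g x"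
      by (intro AE_I2 tendsto_intros t)
    show "AE x in lebesgue_on \<Omega>. norm (\<phi> N x *\<^sub>R g x) \<le> norm (g x)" for N
      using t(2) by (intro AE_I2) (auto intro!: mult_left_le_one_le)
    have "S \<in> sets (lebesgue_on \<Omega>)"
      using S open_domain by (auto simp: sets_restrict_space_iff)
    then show "(\<lambda>x. indicator S x *\<^sub>R g x) \<in> borel_measurable (lebesgue_on \<Omega>)"
      using L2_measurable[OF g] by auto
  qed
  then show "(LINT x|lebesgue_on \<Omega>. indicator S x *\<^sub>R g x) = 0"
    by (simp add: zero LIMSEQ_const_iff)
qed

lemma weak_grad_of_H1:
  assumes "v \<in> H1 \<Omega>"
  shows "v \<in> L2 \<Omega>" "weak_grad \<Omega> v \<in> L2 \<Omega>" "has_weak_gradient \<Omega> v (weak_grad \<Omega> v)"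
proof -
  show "v \<in> L2 \<Omega>" using assms by (simp add: H1_def)
  have "\<exists>g. g \<in> L2 \<Omega> \<and> has_weak_gradient \<Omega> v g" using assms by (auto simp: H1_def)
  from someI_ex[OF this] show "weak_grad \<Omega> v \<in> L2 \<Omega>" "has_weak_gradient \<Omega> v (weak_grad \<Omega> v)"
    by (simp_all add: weak_grad_def)
qed

lemma function_space_H1: "function_space (H1 \<Omega>)"
proof -
  have "(\<lambda>x. 0) \<in> H1 \<Omega>"
    unfolding H1_def has_weak_gradient_def
    by (intro CollectI conjI bexI[of _ "\<lambda>x. 0"]) (auto simp: L2_def)
  moreover have "(\<lambda>x. v x + c * w x) \<in> H1 \<Omega>" if "v \<in> H1 \<Omega>" "w \<in> H1 \<Omega>" for v w c
    using has_weak_gradient_comb[OF weak_grad_of_H1(1)[OF that(1)] weak_grad_of_H1(1)[OF that(2)]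
        weak_grad_of_H1(2)[OF that(1)] weak_grad_of_H1(2)[OF that(2)]
        weak_grad_of_H1(3)[OF that(1)] weak_grad_of_H1(3)[OF that(2)]]
      L2_comb[OF weak_grad_of_H1(2)[OF that(1)] weak_grad_of_H1(2)[OF that(2)]]
      function_spaceD(2)[OF function_space_L2 weak_grad_of_H1(1)[OF that(1)] weak_grad_of_H1(1)[OF that(2)]]
    unfolding H1_def by blast
  ultimately show ?thesis unfolding function_space_def by blast
qed

text \<open>The representative picked by \<open>weak_grad\<close> is arbitrary, so linearity can only hold almost
  everywhere, and it holds because two weak gradients of the same function differ by a weak
  gradient of zero.\<close>
lemma weak_grad_comb_AE:
  assumes v: "v \<in> H1 \<Omega>" and w: "w \<in> H1 \<Omega>"
  shows "AE x in lebesgue_on \<Omega>.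
    weak_grad \<Omega> (\<lambda>x. v x + c * w x) x = weak_grad \<Omega> v x + c *\<^sub>R weak_grad \<Omega> w x"
proof -
  let ?z = "\<lambda>x. v x + c * w x" and ?g = "\<lambda>x. weak_grad \<Omega> v x + c *\<^sub>R weak_grad \<Omega> w x"
  have z: "?z \<in> H1 \<Omega>" by (rule function_spaceD(2)[OF function_space_H1 v w])
  note V = weak_grad_of_H1[OF v] and W = weak_grad_of_H1[OF w] and Z = weak_grad_of_H1[OF z]
  have g: "?g \<in> L2 \<Omega>" "has_weak_gradient \<Omega> ?z ?g"
    by (rule L2_comb[OF V(2) W(2)], rule has_weak_gradient_comb[OF V(1) W(1) V(2) W(2) V(3) W(3)])
  have "has_weak_gradient \<Omega> (\<lambda>x. 0) (\<lambda>x. weak_grad \<Omega> ?z x + (-1) *\<^sub>R ?g x)"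
    using has_weak_gradient_comb[OF Z(1) Z(1) Z(2) g(1) Z(3) g(2), of "-1"] by simp
  from weak_gradient_of_zero_AE[OF L2_comb[OF Z(2) g(1)] this] show ?thesis
    by eventually_elim (simp only: scaleR_minus1_left add_uminus_conv_diff right_minus_eq)
qed

lemma bilin_A_symmetric_form: "symmetric_form (H1 \<Omega>) (bilin_A \<Omega> (\<lambda>_. a))"
proof -
  have "bilin_A \<Omega> (\<lambda>_. a) (\<lambda>x. v x + c * w x) z = bilin_A \<Omega> (\<lambda>_. a) v z + c * bilin_A \<Omega> (\<lambda>_. a) w z"
    if vw: "v \<in> H1 \<Omega>" "w \<in> H1 \<Omega>" and z: "z \<in> H1 \<Omega>" for v w z c
  proof -
    let ?G = "weak_grad \<Omega>"
    note L = weak_grad_of_H1(2)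
    have iv: "integrable (lebesgue_on \<Omega>) (\<lambda>x. ?G v x \<bullet> ?G z x)"
      and iw: "integrable (lebesgue_on \<Omega>) (\<lambda>x. ?G w x \<bullet> ?G z x)"
      by (intro integrable_inner_L2 L vw z)+
    have ivw: "integrable (lebesgue_on \<Omega>) (\<lambda>x. ?G (\<lambda>x. v x + c * w x) x \<bullet> ?G z x)"
      by (intro integrable_inner_L2 L z function_spaceD(2)[OF function_space_H1] vw)
    have "AE x in lebesgue_on \<Omega>. a * (?G (\<lambda>x. v x + c * w x) x \<bullet> ?G z x)
        = a * (?G v x \<bullet> ?G z x) + c * (a * (?G w x \<bullet> ?G z x))"
      using weak_grad_comb_AE[OF vw, of c]
      by eventually_elim (simp add: inner_add_left algebra_simps)
    then have "bilin_A \<Omega> (\<lambda>_. a) (\<lambda>x. v x + c * w x) z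
        = (LINT x|lebesgue_on \<Omega>. a * (?G v x \<bullet> ?G z x) + c * (a * (?G w x \<bullet> ?G z x)))"
      unfolding bilin_A_def using ivw iv iw by (intro integral_cong_AE) auto
    also have "\<dots> = bilin_A \<Omega> (\<lambda>_. a) v z + c * bilin_A \<Omega> (\<lambda>_. a) w z"
      unfolding bilin_A_def using iv iw by (subst Bochner_Integration.integral_add) auto
    finally show ?thesis .
  qed
  then show ?thesis
    by (auto simp: symmetric_form_def linear_form_def bilin_A_def inner_commute)
qed

lemma bilin_A_nonneg: "0 \<le> a \<Longrightarrow> 0 \<le> bilin_A \<Omega> (\<lambda>_. a) v v"
  unfolding bilin_A_def by (intro Bochner_Integration.integral_nonneg) auto

end

section \<open>Finite element spaces\<close>

lemma finite_multi_indices: "finite {\<alpha> :: 'd::finite \<Rightarrow> nat. (\<Sum>i\<in>UNIV. \<alpha> i) \<le> k}"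
proof (rule finite_subset)
  show "{\<alpha> :: 'd \<Rightarrow> nat. (\<Sum>i\<in>UNIV. \<alpha> i) \<le> k} \<subseteq> PiE UNIV (\<lambda>_. {..k})"
  proof (rule subsetI)
    fix \<alpha> :: "'d \<Rightarrow> nat" assume "\<alpha> \<in> {\<alpha>. (\<Sum>i\<in>UNIV. \<alpha> i) \<le> k}"
    then have "\<alpha> i \<le> k" for i
      using member_le_sum[of i UNIV \<alpha>] by auto
    then show "\<alpha> \<in> PiE UNIV (\<lambda>_. {..k})" by auto
  qed
qed (intro finite_PiE, auto)

lemma polynomials_le_spanned:
  "polynomials_le k = spanned_by {\<alpha>. (\<Sum>i\<in>UNIV. \<alpha> i) \<le> k} (\<lambda>\<alpha> x. \<Prod>i\<in>UNIV. x $ i ^ \<alpha> i)"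
  by (auto simp: polynomials_le_def spanned_by_def fun_eq_iff)

text \<open>Elements overlap in faces, so plain indicators times monomials would count a shared point several
  times.  Assigning each point to one chosen element \<open>\<tau> x\<close> gives discontinuous generators
  that reproduce every piecewise polynomial pointwise.\<close>
lemma piecewise_polynomials_spanned:
  fixes \<T> :: "(real^'d) set set"
  assumes "finite \<T>"
  shows "\<exists>(I :: ((real^'d) set \<times> ('d \<Rightarrow> nat)) set) f. finite I \<and>
    {v. (\<forall>x. x \<notin> \<Union>\<T> \<longrightarrow> v x = 0) \<and> (\<forall>T\<in>\<T>. \<exists>p\<in>polynomials_le k. \<forall>x\<in>T. v x = p x)}
      \<subseteq> spanned_by I f"
proof (intro exI conjI)
  define \<tau> where "\<tau> x = (SOME T. T \<in> \<T> \<and> x \<in> T)" for x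
  have \<tau>: "\<tau> x \<in> \<T>" "x \<in> \<tau> x" if "x \<in> \<Union>\<T>" for x
    using someI_ex[of "\<lambda>T. T \<in> \<T> \<and> x \<in> T"] that by (auto simp: \<tau>_def)
  define A :: "('d \<Rightarrow> nat) set" where "A = {\<alpha>. (\<Sum>i\<in>UNIV. \<alpha> i) \<le> k}"
  define f where
    "f = (\<lambda>(T, \<alpha>) x. if x \<in> \<Union>\<T> \<and> \<tau> x = T then \<Prod>i\<in>(UNIV::'d set). x $ i ^ \<alpha> i else (0::real))"
  show "finite (\<T> \<times> A)"
    unfolding A_def using assms finite_multi_indices by (rule finite_cartesian_product)
  show "{v. (\<forall>x. x \<notin> \<Union>\<T> \<longrightarrow> v x = 0) \<and> (\<forall>T\<in>\<T>. \<exists>p\<in>polynomials_le k. \<forall>x\<in>T. v x = p x)}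
      \<subseteq> spanned_by (\<T> \<times> A) f"
  proof safe
    fix v :: "real^'d \<Rightarrow> real"
    assume v0: "\<forall>x. x \<notin> \<Union>\<T> \<longrightarrow> v x = 0"
      and v: "\<forall>T\<in>\<T>. \<exists>p\<in>polynomials_le k. \<forall>x\<in>T. v x = p x"
    from v have "\<forall>T\<in>\<T>. \<exists>c. \<forall>x\<in>T. v x = (\<Sum>\<alpha>\<in>A. c \<alpha> * (\<Prod>i\<in>UNIV. x $ i ^ \<alpha> i))"
      by (fastforce simp: polynomials_le_def A_def)
    then obtain c where c: "\<And>T x. T \<in> \<T> \<Longrightarrow> x \<in> T \<Longrightarrow> v x = (\<Sum>\<alpha>\<in>A. c T \<alpha> * (\<Prod>i\<in>UNIV. x $ i ^ \<alpha> i))"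
      by metis
    have "v x = (\<Sum>(T, \<alpha>)\<in>\<T> \<times> A. c T \<alpha> * f (T, \<alpha>) x)" for x
    proof (cases "x \<in> \<Union>\<T>")
      case True
      have "(\<Sum>(T, \<alpha>)\<in>\<T> \<times> A. c T \<alpha> * f (T, \<alpha>) x) = (\<Sum>T\<in>\<T>. \<Sum>\<alpha>\<in>A. c T \<alpha> * f (T, \<alpha>) x)"
        by (rule sum.cartesian_product[symmetric])
      also have "\<dots> = (\<Sum>T\<in>\<T>. if T = \<tau> x then v x else 0)"
        using True by (intro sum.cong refl) (auto simp: f_def c[OF \<tau>[OF True]])
      also have "\<dots> = v x" using assms \<tau>(1)[OF True] by simp
      finally show ?thesis by simp
    next
      case False
      then have "f (T, \<alpha>) x = 0" for T \<alpha> by (auto simp: f_def)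
      then show ?thesis using v0 False by (simp add: case_prod_beta)
    qed
    then have "v = (\<lambda>x. \<Sum>i\<in>\<T> \<times> A. (\<lambda>(T, \<alpha>). c T \<alpha>) i * f i x)"
      by (auto simp: case_prod_beta)
    then show "v \<in> spanned_by (\<T> \<times> A) f" unfolding spanned_by_def by blast
  qed
qed

context bounded_open_set
begin

lemma function_space_C0: "function_space (C0 \<Omega>)"
  by (auto simp: function_space_def C0_def intro!: continuous_intros)

lemma C0_mult: "v \<in> C0 \<Omega> \<Longrightarrow> w \<in> C0 \<Omega> \<Longrightarrow> (\<lambda>x. v x * w x) \<in> C0 \<Omega>"
  by (auto simp: C0_def intro!: continuous_intros)

lemma C0_subset_L2: "C0 \<Omega> \<subseteq> L2 \<Omega>"
proof
  fix f assume "f \<in> C0 \<Omega>"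
  then have c: "continuous_on (closure \<Omega>) f" by (simp add: C0_def)
  then have "continuous_on (closure \<Omega>) (\<lambda>x. (norm (f x))\<^sup>2)" by (intro continuous_intros)
  then show "f \<in> L2 \<Omega>"
    using integrable_bounded_continuous(1)[OF c] integrable_bounded_continuous(3)
    by (auto simp: L2_def)
qed

lemma l2_inner_nonneg: "0 \<le> l2_inner \<Omega> f f"
  unfolding l2_inner_def by (intro Bochner_Integration.integral_nonneg) auto

lemma l2_norm_square: "(l2_norm \<Omega> f)\<^sup>2 = l2_inner \<Omega> f f"
  using l2_inner_nonneg by (simp add: l2_norm_def)

text \<open>A continuous function vanishing almost everywhere on an open set vanishes on the whole set, since
  nonempty open sets are not negligible; continuity extends this to the closure.\<close>
lemma l2_inner_pos:
  assumes v: "v \<in> C0 \<Omega>" "v \<noteq> (\<lambda>x. 0)"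
  shows "l2_inner \<Omega> v v > 0"
proof (rule ccontr)
  assume "\<not> l2_inner \<Omega> v v > 0"
  then have "(LINT x|lebesgue_on \<Omega>. v x * v x) = 0"
    using l2_inner_nonneg[of v] unfolding l2_inner_def by linarith
  then have "AE x in lebesgue_on \<Omega>. v x * v x = 0"
    using integrable_inner_L2[of v v] C0_subset_L2 v(1)
    by (subst (asm) integral_nonneg_eq_0_iff_AE) auto
  then have "AE x in lebesgue. x \<in> \<Omega> \<longrightarrow> v x = 0"
    using open_domain by (simp add: AE_restrict_space_iff)
  then have "negligible {x \<in> \<Omega>. v x \<noteq> 0}"
    by (auto simp: negligible_iff_null_sets completion.AE_iff_null_sets
        null_sets_def elim!: AE_E2)
  moreover have "open {x \<in> \<Omega>. v x \<noteq> 0}"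
  proof -
    have "continuous_on \<Omega> v"
      using v(1) by (auto simp: C0_def intro: continuous_on_subset[OF _ closure_subset])
    then have "open (v -` (- {0}) \<inter> \<Omega>)"
      using open_domain by (auto simp: continuous_on_open_vimage)
    then show ?thesis by (simp add: vimage_def Int_def conj_commute)
  qed
  ultimately have "\<forall>x\<in>\<Omega>. v x = 0"
    using open_not_negligible by blast
  then have "\<forall>x\<in>closure \<Omega>. v x = 0"
    using continuous_constant_on_closure[of \<Omega> v 0] v(1) by (auto simp: C0_def)
  then show False using v by (auto simp: C0_def fun_eq_iff)
qed

lemma linear_form_l2_inner:
  assumes "V \<subseteq> L2 \<Omega>" "u \<in> L2 \<Omega>"
  shows "linear_form V (l2_inner \<Omega> u)"
proof -
  have "linear_form (L2 \<Omega>) (\<lambda>v. l2_inner \<Omega> v u)"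
    using l2_inner_symmetric_form assms(2) by (auto simp: symmetric_form_def)
  moreover have "(\<lambda>v. l2_inner \<Omega> v u) = l2_inner \<Omega> u"
    by (simp add: fun_eq_iff l2_inner_def mult.commute)
  ultimately show ?thesis using assms(1) by (simp add: linear_form_mono)
qed

text \<open>The projection is a definite description, so even membership in \<open>V\<close> needs existence and
  uniqueness of the projected function.\<close>
lemma l2_projection_mem:
  assumes "finite I" "V \<subseteq> spanned_by I f" "function_space V" "V \<subseteq> C0 \<Omega>" "u \<in> L2 \<Omega>"
  shows "l2_projection \<Omega> V u \<in> V"
proof -
  have VL: "V \<subseteq> L2 \<Omega>" using assms(4) C0_subset_L2 by blast
  from riesz_finite_dimensional[OF assms(1-3) symmetric_form_mono[OF l2_inner_symmetric_form VL] _
      linear_form_l2_inner[OF VL assms(5)]]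
  have "\<exists>!w. w \<in> V \<and> (\<forall>\<phi>\<in>V. l2_inner \<Omega> w \<phi> = l2_inner \<Omega> u \<phi>)"
    using l2_inner_pos assms(4) by blast
  from theI'[OF this] show ?thesis unfolding l2_projection_def by blast
qed

lemma function_space_fe_space: "function_space (fe_space \<Omega> \<T> k)"
proof -
  let ?P = "{v. \<forall>T\<in>\<T>. \<exists>p\<in>polynomials_le k. \<forall>x\<in>T. v x = p x}"
  have P: "function_space (polynomials_le k)"
    unfolding polynomials_le_spanned by (rule function_space_spanned_by)
  have "function_space ?P"
    unfolding function_space_def
  proof (safe)
    show "\<exists>p\<in>polynomials_le k. \<forall>x\<in>T. (0::real) = p x" for T :: "(real^'d) set"
      using function_spaceD(1)[OF P] by (auto intro: bexI[of _ "\<lambda>x. 0"])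
  next
    fix v w c T
    assume "\<forall>T\<in>\<T>. \<exists>p\<in>polynomials_le k. \<forall>x\<in>T. v x = p x"
      "\<forall>T\<in>\<T>. \<exists>p\<in>polynomials_le k. \<forall>x\<in>T. w x = p x" "T \<in> \<T>"
    then obtain p q where "p \<in> polynomials_le k" "q \<in> polynomials_le k"
      "\<forall>x\<in>T. v x = p x" "\<forall>x\<in>T. w x = q x" by metis
    then show "\<exists>p\<in>polynomials_le k. \<forall>x\<in>T. v x + c * w x = p x"
      using function_spaceD(2)[OF P, of p q c] by (intro bexI[of _ "\<lambda>x. p x + c * q x"]) auto
  qed
  moreover have "fe_space \<Omega> \<T> k = C0 \<Omega> \<inter> H1 \<Omega> \<inter> ?P"
    by (auto simp: fe_space_def)
  ultimately show ?thesis
    by (simp only: function_space_Int function_space_C0 function_space_H1)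
qed

lemma fe_space_spanned:
  assumes "quasi_uniform_triangulation \<rho> \<Omega> \<T>"
  shows "\<exists>(I :: ((real^'d) set \<times> ('d \<Rightarrow> nat)) set) f.
    finite I \<and> fe_space \<Omega> \<T> k \<subseteq> spanned_by I f"
proof -
  have T: "finite \<T>" "\<Union>\<T> = closure \<Omega>"
    using assms by (auto simp: quasi_uniform_triangulation_def triangulation_def)
  have "fe_space \<Omega> \<T> k \<subseteq>
    {v. (\<forall>x. x \<notin> \<Union>\<T> \<longrightarrow> v x = 0) \<and> (\<forall>T\<in>\<T>. \<exists>p\<in>polynomials_le k. \<forall>x\<in>T. v x = p x)}"
    unfolding T(2) by (auto simp: fe_space_def C0_def)
  with piecewise_polynomials_spanned[OF T(1), of k] show ?thesis
    by (meson order_trans)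
qed

lemma l2_inner_cong:
  assumes "\<And>x. x \<in> closure \<Omega> \<Longrightarrow> f x = g x"
  shows "l2_inner \<Omega> f \<phi> = l2_inner \<Omega> g \<phi>"
  unfolding l2_inner_def using assms closure_subset[of \<Omega>]
  by (intro Bochner_Integration.integral_cong) auto

end

section \<open>One step of the scheme\<close>

text \<open>The auxiliary equation solved for the new auxiliary variable.\<close>
definition auxiliary_update ::
  "('a \<Rightarrow> real) \<Rightarrow> ('a \<Rightarrow> real) \<Rightarrow> ('a \<Rightarrow> real) \<Rightarrow> ('a \<Rightarrow> real) \<Rightarrow> ('a \<Rightarrow> real) \<Rightarrow> ('a \<Rightarrow> real) \<Rightarrow> 'a \<Rightarrow> real" where
  "auxiliary_update H u0 u1 U0 U1 v =
     (\<lambda>x. (4 * U1 x - U0 x + 1/2 * H x * bdf2 u0 u1 v x) / 3)"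

text \<open>Inserting the solved auxiliary equation into the variational equation leaves a problem for the
  new phase variable alone.  Its left side has the mass coefficient
  \<open>3 / (2 \<Delta>t) + H\<^sup>2 / 2\<close>; the known time levels make up the right side \<open>load\<close>.\<close>
definition condensed_form ::
  "(real^'d) set \<Rightarrow> (real^'d \<Rightarrow> real) \<Rightarrow> real \<Rightarrow> real \<Rightarrow> (real^'d \<Rightarrow> real) \<Rightarrow> (real^'d \<Rightarrow> real) \<Rightarrow> real" where
  "condensed_form \<Omega> H \<epsilon> \<Delta>t v \<phi> =
     l2_inner \<Omega> (\<lambda>x. 3 / (2 * \<Delta>t) * v x + 1/2 * (H x * (H x * v x))) \<phi> + bilin_A \<Omega> (\<lambda>_. \<epsilon>\<^sup>2) v \<phi>"

text \<open>The function \<open>H\<close> is the coefficient at the extrapolated state, extended by zero so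
  that it belongs to \<open>C0\<close>; \<open>u0, u1\<close> and \<open>U0, U1\<close> are the two previous time levels.\<close>
locale ieq_step_data = bounded_open_set \<Omega> for \<Omega> :: "(real^'d) set" +
  fixes V :: "(real^'d \<Rightarrow> real) set" and I :: "'i set" and f :: "'i \<Rightarrow> real^'d \<Rightarrow> real"
    and F :: "real \<Rightarrow> real" and B \<epsilon> \<Delta>t :: real
    and u0 u1 U0 U1 H :: "real^'d \<Rightarrow> real"
  assumes V: "function_space V" "V \<subseteq> C0 \<Omega>" "V \<subseteq> H1 \<Omega>"
    and finite_dim: "finite I" "V \<subseteq> spanned_by I f"
    and step_pos: "\<Delta>t > 0"
    and data: "u0 \<in> V" "u1 \<in> V" "U0 \<in> C0 \<Omega>" "U1 \<in> C0 \<Omega>" "H \<in> C0 \<Omega>"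
    and H: "\<And>x. x \<in> closure \<Omega> \<Longrightarrow> ieq_H F B (extrap u0 u1 x) = H x"
begin

lemma bdf2_C0: "v \<in> V \<Longrightarrow> bdf2 u0 u1 v \<in> C0 \<Omega>"
  using bdf2_mem[OF V(1) data(1,2)] V(2) by blast

lemma auxiliary_update_C0:
  assumes "v \<in> V"
  shows "auxiliary_update H u0 u1 U0 U1 v \<in> C0 \<Omega>"
  using bdf2_C0[OF assms] data
  by (auto simp: C0_def auxiliary_update_def intro!: continuous_intros)

lemma auxiliary_equation_iff:
  assumes "v \<in> V" "W \<in> C0 \<Omega>"
  shows "(\<forall>x\<in>closure \<Omega>. bdf2 U0 U1 W x / (2 * \<Delta>t) =
        1/2 * ieq_H F B (extrap u0 u1 x) * (bdf2 u0 u1 v x / (2 * \<Delta>t)))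
    \<longleftrightarrow> W = auxiliary_update H u0 u1 U0 U1 v" (is "?L \<longleftrightarrow> ?R")
proof -
  have cancel: "a / (2 * \<Delta>t) = c * (b / (2 * \<Delta>t)) \<longleftrightarrow> a = c * b" for a b c
    using step_pos by simp
  have "?L \<longleftrightarrow> (\<forall>x\<in>closure \<Omega>. W x = auxiliary_update H u0 u1 U0 U1 v x)"
  proof (rule ball_cong[OF refl])
    fix x assume "x \<in> closure \<Omega>"
    show "bdf2 U0 U1 W x / (2 * \<Delta>t) = 1/2 * ieq_H F B (extrap u0 u1 x) * (bdf2 u0 u1 v x / (2 * \<Delta>t))
      \<longleftrightarrow> W x = auxiliary_update H u0 u1 U0 U1 v x"
      unfolding H[OF \<open>x \<in> closure \<Omega>\<close>] cancel
      by (auto simp: bdf2_def[of U0] auxiliary_update_def field_simps)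
  qed
  also have "\<dots> \<longleftrightarrow> ?R"
    using assms(2) auxiliary_update_C0[OF assms(1)] by (auto simp: C0_def fun_eq_iff)
  finally show ?thesis .
qed

lemma symmetric_condensed_form: "symmetric_form V (condensed_form \<Omega> H \<epsilon> \<Delta>t)"
proof -
  let ?m = "\<lambda>v x. 3 / (2 * \<Delta>t) * v x + 1/2 * (H x * (H x * v x))"
  have VL: "V \<subseteq> L2 \<Omega>" using V(2) C0_subset_L2 by blast
  have m: "?m v \<in> L2 \<Omega>" if "v \<in> V" for v
  proof -
    have "?m v \<in> C0 \<Omega>"
      using that V(2) data by (intro function_space_comb[OF function_space_C0] C0_mult) auto
    then show ?thesis using C0_subset_L2 by blast
  qed
  have A: "symmetric_form V (bilin_A \<Omega> (\<lambda>_. \<epsilon>\<^sup>2))"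
    using bilin_A_symmetric_form V(3) by (rule symmetric_form_mono)
  have msym: "l2_inner \<Omega> (?m v) w = l2_inner \<Omega> (?m w) v" for v w
    unfolding l2_inner_def by (intro Bochner_Integration.integral_cong) (auto simp: algebra_simps)
  have mlin: "l2_inner \<Omega> (?m (\<lambda>x. v x + c * w x)) z = l2_inner \<Omega> (?m v) z + c * l2_inner \<Omega> (?m w) z"
    if "v \<in> V" "w \<in> V" "z \<in> V" for v w z c
  proof -
    have eq: "?m (\<lambda>x. v x + c * w x) = (\<lambda>x. ?m v x + c * ?m w x)"
      by (auto simp: algebra_simps add_divide_distrib)
    have "linear_form (L2 \<Omega>) (\<lambda>v. l2_inner \<Omega> v z)"
      using l2_inner_symmetric_form that VL by (auto simp: symmetric_form_def)
    then show ?thesis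
      unfolding eq using m[OF that(1)] m[OF that(2)] by (rule linear_formD)
  qed
  have regroup: "(a + c * b) + (p + c * q) = (a + p) + c * (b + q)" for a b c p q :: real
    by (simp add: algebra_simps)
  show ?thesis
    unfolding symmetric_form_def linear_form_def
  proof (intro conjI ballI allI)
    fix v w assume "v \<in> V" "w \<in> V"
    then have "bilin_A \<Omega> (\<lambda>_. \<epsilon>\<^sup>2) v w = bilin_A \<Omega> (\<lambda>_. \<epsilon>\<^sup>2) w v"
      using A by (auto simp: symmetric_form_def)
    with msym show "condensed_form \<Omega> H \<epsilon> \<Delta>t v w = condensed_form \<Omega> H \<epsilon> \<Delta>t w v"
      unfolding condensed_form_def by (rule arg_cong2)
  next
    fix z v w c assume z: "z \<in> V" and vw: "v \<in> V" "w \<in> V"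
    have "linear_form V (\<lambda>v. bilin_A \<Omega> (\<lambda>_. \<epsilon>\<^sup>2) v z)"
      using A z by (auto simp: symmetric_form_def)
    note Alin = linear_formD[OF this vw]
    show "condensed_form \<Omega> H \<epsilon> \<Delta>t (\<lambda>x. v x + c * w x) z =
        condensed_form \<Omega> H \<epsilon> \<Delta>t v z + c * condensed_form \<Omega> H \<epsilon> \<Delta>t w z"
      unfolding condensed_form_def mlin[OF vw z] Alin by (rule regroup)
  qed
qed

text \<open>Both \<open>H\<^sup>2\<close> and the Dirichlet form contribute nonnegatively, so the mass term alone forces
  definiteness, whatever the size of the time step.\<close>
lemma condensed_form_pos:
  assumes v: "v \<in> V" "v \<noteq> (\<lambda>x. 0)"
  shows "condensed_form \<Omega> H \<epsilon> \<Delta>t v v > 0"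
proof -
  have vC: "v \<in> C0 \<Omega>" "(\<lambda>x. H x * v x) \<in> C0 \<Omega>" using v V(2) data C0_mult by auto
  have L: "v \<in> L2 \<Omega>" "(\<lambda>x. H x * (H x * v x)) \<in> L2 \<Omega>"
    using vC data C0_mult C0_subset_L2 by blast+
  have "linear_form (L2 \<Omega>) (\<lambda>w. l2_inner \<Omega> w v)"
    using l2_inner_symmetric_form L(1) by (auto simp: symmetric_form_def)
  note lin = linear_form_comb[OF function_space_L2 this L]
  have "condensed_form \<Omega> H \<epsilon> \<Delta>t v v = 3 / (2 * \<Delta>t) * l2_inner \<Omega> v v
      + 1/2 * l2_inner \<Omega> (\<lambda>x. H x * (H x * v x)) v + bilin_A \<Omega> (\<lambda>_. \<epsilon>\<^sup>2) v v"
    unfolding condensed_form_def by (subst lin) (rule refl)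
  moreover have "3 / (2 * \<Delta>t) * l2_inner \<Omega> v v > 0"
    using step_pos l2_inner_pos[OF vC(1) v(2)] by simp
  moreover have "l2_inner \<Omega> (\<lambda>x. H x * (H x * v x)) v = l2_inner \<Omega> (\<lambda>x. H x * v x) (\<lambda>x. H x * v x)"
    unfolding l2_inner_def by (intro Bochner_Integration.integral_cong) auto
  moreover note l2_inner_nonneg[of "\<lambda>x. H x * v x"] bilin_A_nonneg[of "\<epsilon>\<^sup>2" v]
  ultimately show ?thesis by simp
qed

definition load :: "real^'d \<Rightarrow> real" where
  "load = (\<lambda>x. (4 * u1 x - u0 x) / (2 * \<Delta>t) - H x * (4 * U1 x - U0 x) / 3
     + H x * H x * (4 * u1 x - u0 x) / 6)"

lemma load_L2: "load \<in> L2 \<Omega>"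
proof -
  have "u0 \<in> C0 \<Omega>" "u1 \<in> C0 \<Omega>" using data V(2) by auto
  then have "load \<in> C0 \<Omega>"
    using data step_pos by (auto simp: C0_def load_def intro!: continuous_intros)
  then show ?thesis using C0_subset_L2 by blast
qed

text \<open>Adding up gives pointwise
  \<open>(3 v - 4 u1 + u0) / (2 \<Delta>t) + H W = (3 / (2 \<Delta>t) + H\<^sup>2 / 2) v - load\<close>
  with \<open>W\<close> the updated auxiliary variable, which turns the coupled step into the condensed
  problem.\<close>
lemma step_iff:
  "bdf2_ieq_step \<Omega> V F B \<epsilon> \<Delta>t u0 u1 v U0 U1 W \<longleftrightarrow>
     v \<in> V \<and> (\<forall>\<phi>\<in>V. condensed_form \<Omega> H \<epsilon> \<Delta>t v \<phi> = l2_inner \<Omega> load \<phi>) \<and>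
     W = auxiliary_update H u0 u1 U0 U1 v"
proof -
  have VL: "V \<subseteq> L2 \<Omega>" using V(2) C0_subset_L2 by blast
  let ?W = "auxiliary_update H u0 u1 U0 U1 v"
  let ?P = "\<lambda>x. bdf2 u0 u1 v x / (2 * \<Delta>t)" and ?Q = "\<lambda>x. H x * ?W x"
  let ?m = "\<lambda>x. 3 / (2 * \<Delta>t) * v x + 1/2 * (H x * (H x * v x))"
  have "l2_inner \<Omega> ?P \<phi> = - bilin_A \<Omega> (\<lambda>_. \<epsilon>\<^sup>2) v \<phi>
          - l2_inner \<Omega> (\<lambda>x. ieq_H F B (extrap u0 u1 x) * ?W x) \<phi>
      \<longleftrightarrow> condensed_form \<Omega> H \<epsilon> \<Delta>t v \<phi> = l2_inner \<Omega> load \<phi>" if v: "v \<in> V" and \<phi>: "\<phi> \<in> V" for \<phi>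
  proof -
    have lin: "linear_form (L2 \<Omega>) (\<lambda>w. l2_inner \<Omega> w \<phi>)"
      using l2_inner_symmetric_form \<phi> VL by (auto simp: symmetric_form_def)
    have P: "?P \<in> L2 \<Omega>"
      using function_space_scale[OF function_space_C0 bdf2_C0[OF v], of "1 / (2 * \<Delta>t)"]
        C0_subset_L2 by auto
    have Q: "?Q \<in> L2 \<Omega>"
      using C0_mult[OF data(5) auxiliary_update_C0[OF v]] C0_subset_L2 by blast
    have "?m = (\<lambda>x. (?P x + 1 * ?Q x) + 1 * load x)"
      using step_pos by (auto simp: load_def auxiliary_update_def bdf2_def field_simps)
    then have "l2_inner \<Omega> ?m \<phi> = l2_inner \<Omega> ?P \<phi> + l2_inner \<Omega> ?Q \<phi> + l2_inner \<Omega> load \<phi>"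
      using linear_formD[OF lin P Q, of 1]
        linear_formD[OF lin function_spaceD(2)[OF function_space_L2 P Q, of 1] load_L2, of 1] by simp
    moreover have "l2_inner \<Omega> (\<lambda>x. ieq_H F B (extrap u0 u1 x) * ?W x) \<phi> = l2_inner \<Omega> ?Q \<phi>"
      by (rule l2_inner_cong) (simp add: H)
    ultimately show ?thesis by (auto simp: condensed_form_def)
  qed
  then show ?thesis
    unfolding bdf2_ieq_step_def using auxiliary_equation_iff auxiliary_update_C0 by blast
qed

lemma unique_step:
  obtains v W where "bdf2_ieq_step \<Omega> V F B \<epsilon> \<Delta>t u0 u1 v U0 U1 W"
    "\<And>v' W'. bdf2_ieq_step \<Omega> V F B \<epsilon> \<Delta>t u0 u1 v' U0 U1 W' \<Longrightarrow> v' = v \<and> W' = W"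
proof -
  have VL: "V \<subseteq> L2 \<Omega>" using V(2) C0_subset_L2 by blast
  from riesz_finite_dimensional[OF finite_dim V(1) symmetric_condensed_form condensed_form_pos
      linear_form_l2_inner[OF VL load_L2]]
  have "\<exists>!v. v \<in> V \<and> (\<forall>\<phi>\<in>V. condensed_form \<Omega> H \<epsilon> \<Delta>t v \<phi> = l2_inner \<Omega> load \<phi>)" .
  then show thesis using that unfolding step_iff by metis
qed

text \<open>Test the variational equation with \<open>D = 3 v - 4 u1 + u0\<close>.  By the auxiliary equation, on the closure of the domain
  \<open>H D = 2 (3 W - 4 U1 + U0)\<close>, so the nonlinear term becomes \<open>2 (W, 3 W - 4 U1 + U0)\<close>, and
  the BDF2 identity applies to it as well as to the gradient term.\<close>
lemma energy_law:
  assumes step: "bdf2_ieq_step \<Omega> V F B \<epsilon> \<Delta>t u0 u1 v U0 U1 W"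
  shows "energy_bar \<Omega> \<epsilon> B u1 v U1 W = energy_bar \<Omega> \<epsilon> B u0 u1 U0 U1
        - 1 / (4 * \<Delta>t) * (l2_norm \<Omega> (bdf2 u0 u1 v))\<^sup>2
        - 1/4 * bilin_A \<Omega> (\<lambda>_. \<epsilon>\<^sup>2) (\<lambda>x. v x - extrap u0 u1 x) (\<lambda>x. v x - extrap u0 u1 x)
        - 1/2 * (l2_norm \<Omega> (\<lambda>x. W x - extrap U0 U1 x))\<^sup>2"
proof -
  let ?A = "bilin_A \<Omega> (\<lambda>_. \<epsilon>\<^sup>2)" and ?D = "bdf2 u0 u1 v" and ?DU = "bdf2 U0 U1 W"
  have v: "v \<in> V" and W: "W \<in> C0 \<Omega>" and D: "?D \<in> V"
    using step bdf2_mem[OF V(1) data(1,2)] by (auto simp: bdf2_ieq_step_def)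
  have C0_form: "symmetric_form (C0 \<Omega>) (l2_inner \<Omega>)"
    using l2_inner_symmetric_form C0_subset_L2 by (rule symmetric_form_mono)
  have A_form: "symmetric_form V ?A"
    using bilin_A_symmetric_form V(3) by (rule symmetric_form_mono)
  have lin: "linear_form (C0 \<Omega>) (\<lambda>w. l2_inner \<Omega> w ?D)"
    using C0_form bdf2_C0[OF v] by (auto simp: symmetric_form_def)
  have "l2_inner \<Omega> (\<lambda>x. ?D x / (2 * \<Delta>t)) ?D =
      - ?A v ?D - l2_inner \<Omega> (\<lambda>x. ieq_H F B (extrap u0 u1 x) * W x) ?D"
    using step D by (auto simp: bdf2_ieq_step_def)
  moreover have "l2_inner \<Omega> (\<lambda>x. ?D x / (2 * \<Delta>t)) ?D = 2 * (1 / (4 * \<Delta>t) * l2_inner \<Omega> ?D ?D)"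
    using linear_form_scale[OF function_space_C0 lin bdf2_C0[OF v], of "1 / (2 * \<Delta>t)"] by simp
  moreover have "l2_inner \<Omega> (\<lambda>x. ieq_H F B (extrap u0 u1 x) * W x) ?D = 2 * l2_inner \<Omega> W ?DU"
  proof -
    have "ieq_H F B (extrap u0 u1 x) * W x * ?D x = 2 * (W x * ?DU x)" if "x \<in> closure \<Omega>" for x
    proof -
      have "?DU x / (2 * \<Delta>t) = 1/2 * ieq_H F B (extrap u0 u1 x) * (?D x / (2 * \<Delta>t))"
        using step that by (auto simp: bdf2_ieq_step_def)
      then have "ieq_H F B (extrap u0 u1 x) * ?D x = 2 * ?DU x"
        using step_pos by (simp add: field_simps)
      then show ?thesis by algebra
    qed
    then have "l2_inner \<Omega> (\<lambda>x. ieq_H F B (extrap u0 u1 x) * W x) ?D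
        = (LINT x|lebesgue_on \<Omega>. 2 * (W x * ?DU x))"
      unfolding l2_inner_def using closure_subset[of \<Omega>]
      by (intro Bochner_Integration.integral_cong) auto
    then show ?thesis by (simp add: l2_inner_def)
  qed
  moreover note bdf2_identity[OF V(1) A_form data(1,2) v]
    bdf2_identity[OF function_space_C0 C0_form data(3,4) W]
  moreover have "(LINT x|lebesgue_on \<Omega>. (w x)\<^sup>2) = l2_inner \<Omega> w w" for w
    by (simp add: l2_inner_def power2_eq_square)
  ultimately show ?thesis
    unfolding energy_bar_def energy_def l2_norm_square by simp argo
qed

end

theorem theoremB3:
  fixes \<Omega> :: "(real^'d) set" and \<T> :: "(real^'d) set set"
    and k :: nat and \<rho> \<epsilon> B \<Delta>t :: real
    and F :: "real \<Rightarrow> real" and J :: "real set"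
    and u\<^sub>0 :: "real^'d \<Rightarrow> real"
    and u U :: "int \<Rightarrow> real^'d \<Rightarrow> real" and n :: int
  assumes dim: "CARD('d) = 2 \<or> CARD('d) = 3"
    and domain: "open \<Omega>" "connected \<Omega>" "bounded \<Omega>" "\<Omega> \<noteq> {}"
    and mesh: "quasi_uniform_triangulation \<rho> \<Omega> \<T>"
    and params: "\<epsilon> > 0" "B \<ge> 0" "\<Delta>t > 0"
    and potential: "open J" "F differentiable_on J" "continuous_on J (deriv F)"
    and initial_data: "u\<^sub>0 \<in> L2 \<Omega>" "\<And>x. x \<in> closure \<Omega> \<Longrightarrow> F (u\<^sub>0 x) + B > 0"
      "continuous_on (closure \<Omega>) (\<lambda>x. sqrt (F (u\<^sub>0 x) + B))"
    and init_u: "u (-1) = l2_projection \<Omega> (fe_space \<Omega> \<T> k) u\<^sub>0"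
      "u 0 = l2_projection \<Omega> (fe_space \<Omega> \<T> k) u\<^sub>0"
    and init_U: "U (-1) = (\<lambda>x. if x \<in> closure \<Omega> then sqrt (F (u\<^sub>0 x) + B) else 0)"
      "U 0 = (\<lambda>x. if x \<in> closure \<Omega> then sqrt (F (u\<^sub>0 x) + B) else 0)"
    and n: "n \<ge> 0"
    and history: "\<And>m. 0 \<le> m \<Longrightarrow> m < n \<Longrightarrow>
      bdf2_ieq_step \<Omega> (fe_space \<Omega> \<T> k) F B \<epsilon> \<Delta>t
        (u (m - 1)) (u m) (u (m + 1)) (U (m - 1)) (U m) (U (m + 1))"
    and F_pos: "\<And>m x. 0 \<le> m \<Longrightarrow> m \<le> n \<Longrightarrow> x \<in> closure \<Omega> \<Longrightarrow>
      extrap (u (m - 1)) (u m) x \<in> J \<and> F (extrap (u (m - 1)) (u m) x) + B > 0"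
  shows "\<exists>v V.
      bdf2_ieq_step \<Omega> (fe_space \<Omega> \<T> k) F B \<epsilon> \<Delta>t (u (n - 1)) (u n) v (U (n - 1)) (U n) V \<and>
      (\<forall>v' V'. bdf2_ieq_step \<Omega> (fe_space \<Omega> \<T> k) F B \<epsilon> \<Delta>t
          (u (n - 1)) (u n) v' (U (n - 1)) (U n) V' \<longrightarrow> v' = v \<and> V' = V) \<and>
      energy_bar \<Omega> \<epsilon> B (u n) v (U n) V =
        energy_bar \<Omega> \<epsilon> B (u (n - 1)) (u n) (U (n - 1)) (U n)
        - 1 / (4 * \<Delta>t) * (l2_norm \<Omega> (bdf2 (u (n - 1)) (u n) v))\<^sup>2
        - 1/4 * bilin_A \<Omega> (\<lambda>_. \<epsilon>\<^sup>2) (\<lambda>x. v x - extrap (u (n - 1)) (u n) x)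
                             (\<lambda>x. v x - extrap (u (n - 1)) (u n) x)
        - 1/2 * (l2_norm \<Omega> (\<lambda>x. V x - extrap (U (n - 1)) (U n) x))\<^sup>2"
proof -
  interpret bounded_open_set \<Omega>
    using domain by unfold_locales
  let ?V = "fe_space \<Omega> \<T> k"
  obtain I :: "((real^'d) set \<times> ('d \<Rightarrow> nat)) set" and f
    where I: "finite I" "?V \<subseteq> spanned_by I f"
    using fe_space_spanned[OF mesh] by blast
  have V: "function_space ?V" "?V \<subseteq> C0 \<Omega>" "?V \<subseteq> H1 \<Omega>"
    using function_space_fe_space by (auto simp: fe_space_def)
  have mem: "u m \<in> ?V \<and> U m \<in> C0 \<Omega>" if m: "-1 \<le> m" "m \<le> n" for m
  proof -
    have u: "l2_projection \<Omega> ?V u\<^sub>0 \<in> ?V"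
      by (rule l2_projection_mem[OF I V(1,2) initial_data(1)])
    have U: "(\<lambda>x. if x \<in> closure \<Omega> then sqrt (F (u\<^sub>0 x) + B) else 0) \<in> C0 \<Omega>"
      using initial_data(3) by (simp add: C0_def cong: continuous_on_cong_simp)
    consider "m = -1" | "m = 0" | "m \<ge> 1" using m(1) by linarith
    then show ?thesis
    proof cases
      case 3
      then show ?thesis using history[of "m - 1"] m by (auto simp: bdf2_ieq_step_def)
    qed (simp_all add: init_u init_U u U)
  qed
  define w where "w = extrap (u (n - 1)) (u n)"
  have w: "continuous_on (closure \<Omega>) w" "\<And>x. x \<in> closure \<Omega> \<Longrightarrow> w x \<in> J"
    "\<And>x. x \<in> closure \<Omega> \<Longrightarrow> F (w x) + B > 0"
  proof -
    have "w \<in> C0 \<Omega>"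
      unfolding w_def using mem[of n] mem[of "n - 1"] n V(2)
      by (intro extrap_mem[OF function_space_C0]) auto
    then show "continuous_on (closure \<Omega>) w" by (simp add: C0_def)
  qed (use F_pos[of n] n in \<open>auto simp: w_def\<close>)
  define H where "H x = (if x \<in> closure \<Omega> then ieq_H F B (w x) else 0)" for x
  have "continuous_on (closure \<Omega>) (\<lambda>x. ieq_H F B (w x))"
  proof -
    have "continuous_on (closure \<Omega>) (\<lambda>x. F (w x))" "continuous_on (closure \<Omega>) (\<lambda>x. deriv F (w x))"
      using w potential(3) differentiable_imp_continuous_on[OF potential(2)]
      by (auto intro: continuous_on_compose2)
    then show ?thesis
      unfolding ieq_H_def using w(3) by (intro continuous_intros) (auto simp: less_imp_neq[symmetric])
  qed
  then have HC: "H \<in> C0 \<Omega>"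
    by (simp add: C0_def H_def cong: continuous_on_cong_simp)
  interpret ieq_step_data \<Omega> ?V I f F B \<epsilon> \<Delta>t "u (n - 1)" "u n" "U (n - 1)" "U n" H
    using V I params(3) mem[of n] mem[of "n - 1"] n HC by unfold_locales (auto simp: H_def w_def)
  obtain v W where "bdf2_ieq_step \<Omega> ?V F B \<epsilon> \<Delta>t (u (n - 1)) (u n) v (U (n - 1)) (U n) W"
    "\<And>v' W'. bdf2_ieq_step \<Omega> ?V F B \<epsilon> \<Delta>t (u (n - 1)) (u n) v' (U (n - 1)) (U n) W'
       \<Longrightarrow> v' = v \<and> W' = W"
    using unique_step by metis
  then show ?thesis using energy_law by blast
qed

end
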